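(* Let $(u,\tau)$ be a solution, belonging to $$\big(C([0,+\infty);H^1)\cap L^2_{loc}([0,+\infty);H^2)\big)\times C([0,+\infty);H^1),$$ of the system $$\rho\,\partial_t u=\eta\,\partial_{yy}u+\partial_y\tau,\qquad \lambda\,\partial_t\tau=G\,\partial_y u,$$ supplied with homogeneous boundary conditions $u(t,0)=u(t,1)=0$, and let $\tau_0=\tau(0,\cdot)$. Then the solution converges exponentially fast to the steady state $(0,\overline{\tau_0})$ in $H^1(\Omega)\times L^2(\Omega)$ in the long time: there exist two constants $C>0$, independent of time and of the initial data, and $C_0$, independent of time, such that, for $t$ sufficiently large, $$\|\partial_y u(t,\cdot)\|_{L^2}+\|\tau(t,\cdot)-\overline{\tau_0}\|_{L^2}\le C_0e^{-Ct}.$$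
   Context: $\Omega=[0,1]$ with space variable $y$; $t\ge0$ is time; $\rho,\eta,\lambda,G$ are positive constants; $u,\tau$ are real-valued functions of $(t,y)$. $\overline{\tau_0}=\int_\Omega\tau_0(y)\,dy$ is the spatial average of $\tau_0$. All function spaces in $y$ are over $\Omega$. *)

theory Defs
  imports "HOL-Analysis.Analysis"
begin

text \<open>
  Elements of the function spaces over \<open>[0,1]\<close> are represented by functions on the reals, of
  which only the values on \<open>[0,1]\<close>, up to null sets, matter.
\<close>

definition L2 :: "(real \<Rightarrow> real) set" where
  "L2 = {f \<in> borel_measurable (lebesgue_on {0..1}). integrable (lebesgue_on {0..1}) (\<lambda>y. (f y)\<^sup>2)}"

definition L2_norm :: "(real \<Rightarrow> real) \<Rightarrow> real" where
  "L2_norm f = sqrt (LINT y|lebesgue_on {0..1}. (f y)\<^sup>2)"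

definition test_fun :: "(real \<Rightarrow> real) \<Rightarrow> bool" where
  "test_fun \<phi> \<longleftrightarrow>
     (\<forall>k x. (deriv ^^ k) \<phi> field_differentiable at x) \<and>
     (\<exists>K. compact K \<and> K \<subseteq> {0<..<1} \<and> (\<forall>x. x \<notin> K \<longrightarrow> \<phi> x = 0))"

definition weak_deriv :: "(real \<Rightarrow> real) \<Rightarrow> (real \<Rightarrow> real) \<Rightarrow> bool" where
  "weak_deriv f g \<longleftrightarrow>
     (\<forall>\<phi>. test_fun \<phi> \<longrightarrow>
        (LINT y|lebesgue_on {0..1}. f y * deriv \<phi> y) = - (LINT y|lebesgue_on {0..1}. g y * \<phi> y))"

definition H1 :: "(real \<Rightarrow> real) set" where
  "H1 = {f \<in> L2. \<exists>g\<in>L2. weak_deriv f g}"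

text \<open>For \<open>f \<in> H1\<close> the weak derivative is unique up to null sets.\<close>

definition Dy :: "(real \<Rightarrow> real) \<Rightarrow> real \<Rightarrow> real" where
  "Dy f = (SOME g. g \<in> L2 \<and> weak_deriv f g)"

definition H2 :: "(real \<Rightarrow> real) set" where
  "H2 = {f \<in> H1. Dy f \<in> H1}"

definition H1_norm :: "(real \<Rightarrow> real) \<Rightarrow> real" where
  "H1_norm f = sqrt ((L2_norm f)\<^sup>2 + (L2_norm (Dy f))\<^sup>2)"

definition H2_norm :: "(real \<Rightarrow> real) \<Rightarrow> real" where
  "H2_norm f = sqrt ((L2_norm f)\<^sup>2 + (L2_norm (Dy f))\<^sup>2 + (L2_norm (Dy (Dy f)))\<^sup>2)"

text \<open>
  Spaces of functions of time with values in the normed space with elements \<open>X\<close> and norm \<open>N\<close>: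
  \<open>C([0,\<infinity>);X)\<close>, and \<open>L\<^sup>2\<^sub>l\<^sub>o\<^sub>c([0,\<infinity>);X)\<close> in the sense of Bochner.
\<close>

definition C_time ::
  "(real \<Rightarrow> real) set \<Rightarrow> ((real \<Rightarrow> real) \<Rightarrow> real) \<Rightarrow> (real \<Rightarrow> real \<Rightarrow> real) set" where
  "C_time X N = {u. (\<forall>t\<ge>0. u t \<in> X) \<and>
     (\<forall>s\<ge>0. ((\<lambda>t. N (\<lambda>y. u t y - u s y)) \<longlongrightarrow> 0) (at s within {0..}))}"

definition strongly_measurable ::
  "(real \<Rightarrow> real) set \<Rightarrow> ((real \<Rightarrow> real) \<Rightarrow> real) \<Rightarrow> (real \<Rightarrow> real \<Rightarrow> real) \<Rightarrow> bool" where
  "strongly_measurable X N u \<longleftrightarrow>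
     (\<exists>S. (\<forall>n. simple_function (lebesgue_on {0..}) (S n) \<and> (\<forall>t\<ge>0. S n t \<in> X)) \<and>
          (AE t in lebesgue_on {0..}. (\<lambda>n. N (\<lambda>y. S n t y - u t y)) \<longlonglongrightarrow> 0))"

definition L2loc_time ::
  "(real \<Rightarrow> real) set \<Rightarrow> ((real \<Rightarrow> real) \<Rightarrow> real) \<Rightarrow> (real \<Rightarrow> real \<Rightarrow> real) set" where
  "L2loc_time X N = {u. (AE t in lebesgue_on {0..}. u t \<in> X) \<and> strongly_measurable X N u \<and>
     (\<forall>T>0. integrable (lebesgue_on {0..T}) (\<lambda>t. (N (u t))\<^sup>2))}"

text \<open>
  \<open>C\<^sub>c\<^sup>\<infinity>((0,\<infinity>) \<times> (0,1))\<close>; \<open>D i j\<close> is the partial derivative of \<open>\<phi>\<close> of order \<open>i\<close> in time and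
  \<open>j\<close> in space.
\<close>

definition test_fun2 :: "(real \<Rightarrow> real \<Rightarrow> real) \<Rightarrow> bool" where
  "test_fun2 \<phi> \<longleftrightarrow>
     (\<exists>D :: nat \<Rightarrow> nat \<Rightarrow> real \<Rightarrow> real \<Rightarrow> real. D 0 0 = \<phi> \<and>
        (\<forall>i j. continuous_on UNIV (\<lambda>(t, y). D i j t y) \<and>
           (\<forall>t y. ((\<lambda>s. D i j s y) has_real_derivative D (Suc i) j t y) (at t) \<and>
                  (D i j t has_real_derivative D i (Suc j) t y) (at y)))) \<and>
     (\<exists>K. compact K \<and> K \<subseteq> {0<..} \<times> {0<..<1} \<and> (\<forall>t y. (t, y) \<notin> K \<longrightarrow> \<phi> t y = 0))"

text \<open>
  Distributions on \<open>(0,\<infinity>) \<times> (0,1)\<close>. The integral is iterated, so that it does not depend on which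
  representative of \<open>u t\<close> is chosen for each \<open>t\<close>.
\<close>

type_synonym distribution = "(real \<Rightarrow> real \<Rightarrow> real) \<Rightarrow> real"

definition distr :: "(real \<Rightarrow> real \<Rightarrow> real) \<Rightarrow> distribution" where
  "distr u = (\<lambda>\<phi>. LINT t|lebesgue_on {0..}. (LINT y|lebesgue_on {0..1}. u t y * \<phi> t y))"

definition dist_dt :: "distribution \<Rightarrow> distribution" where
  "dist_dt F = (\<lambda>\<phi>. - F (\<lambda>t y. deriv (\<lambda>s. \<phi> s y) t))"

definition dist_dy :: "distribution \<Rightarrow> distribution" where
  "dist_dy F = (\<lambda>\<phi>. - F (\<lambda>t y. deriv (\<phi> t) y))"

definition solves_system ::
  "real \<Rightarrow> real \<Rightarrow> real \<Rightarrow> real \<Rightarrow> (real \<Rightarrow> real \<Rightarrow> real) \<Rightarrow> (real \<Rightarrow> real \<Rightarrow> real) \<Rightarrow> bool" where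
  "solves_system \<rho> \<eta> lam G u \<tau> \<longleftrightarrow>
     (\<forall>\<phi>. test_fun2 \<phi> \<longrightarrow>
        \<rho> * dist_dt (distr u) \<phi> = \<eta> * dist_dy (dist_dy (distr u)) \<phi> + dist_dy (distr \<tau>) \<phi> \<and>
        lam * dist_dt (distr \<tau>) \<phi> = G * dist_dy (distr u) \<phi>)"

text \<open>
  Vanishing boundary trace: an element of \<open>H1\<close> takes boundary values through its (unique)
  continuous representative.
\<close>

definition zero_boundary :: "(real \<Rightarrow> real) \<Rightarrow> bool" where
  "zero_boundary f \<longleftrightarrow>
     (\<exists>v. continuous_on {0..1} v \<and> (AE y in lebesgue_on {0..1}. v y = f y) \<and> v 0 = 0 \<and> v 1 = 0)"

definition mean :: "(real \<Rightarrow> real) \<Rightarrow> real" where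
  "mean f = (LINT y|lebesgue_on {0..1}. f y)"

end

theory Submission
  imports Defs
begin

text \<open>
The system is linear, and on \<open>[0,1]\<close> it decouples in the cosines \<open>cos (n \<pi> y)\<close>. Let \<open>p\<close> and \<open>b\<close> be
the coefficients of \<open>\<partial>\<^sub>y u\<close> and \<open>\<tau>\<close>, and \<open>k = n \<pi>\<close>. Then, formally,
\<open>\<rho> p' = - k\<^sup>2 (\<eta> p + b)\<close> and \<open>\<lambda> b' = G p\<close>. The theorem follows from three facts.

(1) Each mode with \<open>n \<ge> 1\<close> decays exponentially, with a rate and a constant that do not depend on
\<open>n\<close> (\<open>mode_decay\<close>). The physical energy \<open>\<rho> p\<^sup>2 / k\<^sup>2 + \<lambda> b\<^sup>2 / G\<close> dissipates only \<open>p\<close>, and it controls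
\<open>p\<close> badly for large \<open>k\<close>. The total stress \<open>q = \<eta> p + b\<close> repairs both defects: it satisfies
\<open>q' = - (\<eta> k\<^sup>2 / \<rho>) q + (G / \<lambda>) p\<close>, hence is damped at least at the rate \<open>\<eta> \<pi>\<^sup>2 / \<rho>\<close>, and \<open>p\<close> and \<open>q\<close>
together control \<open>b\<close>. A large multiple of the energy plus \<open>q\<^sup>2\<close> is therefore a Lyapunov function whose
dissipation is comparable with itself, uniformly in \<open>k \<ge> \<pi>\<close>.

(2) The mode \<open>n = 0\<close> does not move: \<open>\<partial>\<^sub>y u\<close> has mean zero because \<open>u\<close> vanishes at both ends, so the
mean of \<open>\<tau>\<close> is conserved. This is why the limit of \<open>\<tau>\<close> is the mean of its initial value.

(3) The cosines are complete in \<open>L\<^sup>2\<close> (\<open>Parseval_cosn\<close>), so the estimates of the single modes add up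
to an estimate of the norms, with Bessel's inequality at time \<open>0\<close>.

What remains is to derive the equations of the modes from the distributional formulation, in which
only compactly supported test functions are available. The products \<open>\<chi>(t) \<psi>(y) cos (n \<pi> y)\<close> and
\<open>\<chi>(t) \<psi>(y) sin (n \<pi> y)\<close> are test functions when \<open>\<chi>\<close> and \<open>\<psi>\<close> are smooth cutoffs of
\<open>[0,T]\<close> and \<open>[0,1]\<close>. As the cutoffs tend to \<open>1\<close>, their derivatives act on a continuous function as
the difference of two point masses at the ends (\<open>dcutoff_integral_tendsto\<close>). In time this produces the
increments of the coefficients between \<open>0\<close> and \<open>T\<close>. In space the boundary terms vanish: for the
sine because it is zero at the ends, for the cosine because \<open>u\<close> is (\<open>inner_Dy_cosn\<close>).
\<close>

section \<open>The space L2\<close>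

abbreviation I01 :: "real measure" where
  "I01 \<equiv> lebesgue_on {0..1}"

definition L2_inner :: "(real \<Rightarrow> real) \<Rightarrow> (real \<Rightarrow> real) \<Rightarrow> real" where
  "L2_inner f g = (LINT y|I01. f y * g y)"

lemma L2_D:
  assumes "f \<in> L2"
  shows "f \<in> borel_measurable I01" "integrable I01 (\<lambda>y. (f y)\<^sup>2)"
  using assms by (auto simp: L2_def)

lemma L2_mult_integrable:
  assumes f: "f \<in> L2" and g: "g \<in> L2"
  shows "integrable I01 (\<lambda>y. f y * g y)"
proof (rule Bochner_Integration.integrable_bound)
  show "integrable I01 (\<lambda>y. (f y)\<^sup>2 + (g y)\<^sup>2)"
    using L2_D(2)[OF f] L2_D(2)[OF g] by simp
  show "(\<lambda>y. f y * g y) \<in> borel_measurable I01"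
    using L2_D(1)[OF f] L2_D(1)[OF g] by simp
  have "\<bar>a * b\<bar> \<le> a\<^sup>2 + b\<^sup>2" for a b :: real
  proof -
    have "2 * (\<bar>a\<bar> * \<bar>b\<bar>) \<le> \<bar>a\<bar>\<^sup>2 + \<bar>b\<bar>\<^sup>2"
      using sum_squares_bound[of "\<bar>a\<bar>" "\<bar>b\<bar>"] by (simp add: mult.assoc)
    moreover have "0 \<le> \<bar>a\<bar> * \<bar>b\<bar>" by simp
    ultimately show ?thesis unfolding abs_mult power2_abs by linarith
  qed
  then show "AE y in I01. norm (f y * g y) \<le> norm ((f y)\<^sup>2 + (g y)\<^sup>2)"
    by (intro AE_I2) (metis abs_of_nonneg add_nonneg_nonneg real_norm_def zero_le_power2)
qed

lemma L2_add:
  assumes f: "f \<in> L2" and g: "g \<in> L2"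
  shows "(\<lambda>y. f y + g y) \<in> L2"
  using L2_D[OF f] L2_D[OF g] L2_mult_integrable[OF f g]
  by (simp add: L2_def power2_sum mult.assoc)

lemma L2_scale:
  assumes f: "f \<in> L2"
  shows "(\<lambda>y. c * f y) \<in> L2"
  using L2_D[OF f] by (simp add: L2_def power_mult_distrib)

lemma L2_diff:
  assumes f: "f \<in> L2" and g: "g \<in> L2"
  shows "(\<lambda>y. f y - g y) \<in> L2"
  using L2_add[OF f L2_scale[OF g, of "-1"]] by simp

lemma L2_bounded:
  assumes "f \<in> borel_measurable I01" "\<And>y. y \<in> {0..1} \<Longrightarrow> \<bar>f y\<bar> \<le> B"
  shows "f \<in> L2"
proof -
  have "integrable I01 (\<lambda>y. (f y)\<^sup>2)"
  proof (rule Bochner_Integration.integrable_bound)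
    show "integrable I01 (\<lambda>y. B\<^sup>2)"
      by (rule continuous_imp_integrable_real) simp
    show "AE y in I01. norm ((f y)\<^sup>2) \<le> norm (B\<^sup>2)"
      using assms(2) by (intro AE_I2) (simp add: abs_le_square_iff[symmetric] order_trans[OF _ abs_ge_self])
  qed (use assms(1) in simp)
  then show ?thesis using assms(1) by (simp add: L2_def)
qed

lemma continuous_borel_I01:
  fixes f :: "real \<Rightarrow> real"
  assumes "continuous_on {0..1} f"
  shows "f \<in> borel_measurable I01"
  by (rule continuous_imp_measurable_on_sets_lebesgue[OF assms]) simp

lemma L2_continuous:
  assumes "continuous_on {0..1} f"
  shows "f \<in> L2"
proof -
  have "bounded (f ` {0..1})"
    using assms compact_Icc compact_continuous_image compact_imp_bounded by blast
  then obtain B where "\<And>y. y \<in> {0..1} \<Longrightarrow> \<bar>f y\<bar> \<le> B"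
    by (force simp: bounded_iff)
  then show ?thesis using L2_bounded continuous_borel_I01[OF assms] by blast
qed

lemma L2_const: "(\<lambda>_. c) \<in> L2"
  by (rule L2_continuous) simp

lemma L2_inner_commute: "L2_inner f g = L2_inner g f"
  by (simp add: L2_inner_def mult.commute)

lemma L2_inner_add_left:
  assumes "f \<in> L2" "g \<in> L2" "h \<in> L2"
  shows "L2_inner (\<lambda>y. f y + g y) h = L2_inner f h + L2_inner g h"
  using assms by (simp add: L2_inner_def distrib_right L2_mult_integrable)

lemma L2_inner_scale_left: "L2_inner (\<lambda>y. c * f y) h = c * L2_inner f h"
  by (simp add: L2_inner_def mult.assoc)

lemma L2_inner_diff_left:
  assumes "f \<in> L2" "g \<in> L2" "h \<in> L2"
  shows "L2_inner (\<lambda>y. f y - g y) h = L2_inner f h - L2_inner g h"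
  using assms by (simp add: L2_inner_def left_diff_distrib L2_mult_integrable)

lemma L2_inner_add_right:
  assumes "f \<in> L2" "g \<in> L2" "h \<in> L2"
  shows "L2_inner h (\<lambda>y. f y + g y) = L2_inner h f + L2_inner h g"
  using L2_inner_add_left[OF assms] by (simp add: L2_inner_commute)

lemma L2_inner_scale_right: "L2_inner h (\<lambda>y. c * f y) = c * L2_inner h f"
  using L2_inner_scale_left by (simp add: L2_inner_commute)

lemma L2_inner_diff_right:
  assumes "f \<in> L2" "g \<in> L2" "h \<in> L2"
  shows "L2_inner h (\<lambda>y. f y - g y) = L2_inner h f - L2_inner h g"
  using L2_inner_diff_left[OF assms] by (simp add: L2_inner_commute)

lemma L2_sum:
  assumes "\<And>n. n \<in> A \<Longrightarrow> g n \<in> L2"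
  shows "(\<lambda>y. \<Sum>n\<in>A. g n y) \<in> L2"
  using assms
proof (induction A rule: infinite_finite_induct)
  case (insert x F) then show ?case by (simp add: L2_add)
qed (auto intro: L2_continuous)

lemma L2_inner_sum_right:
  assumes "\<And>n. n \<in> A \<Longrightarrow> g n \<in> L2" "f \<in> L2"
  shows "L2_inner f (\<lambda>y. \<Sum>n\<in>A. g n y) = (\<Sum>n\<in>A. L2_inner f (g n))"
  using assms by (simp add: L2_inner_def sum_distrib_left L2_mult_integrable)

lemma L2_norm_nonneg: "0 \<le> L2_norm f"
  by (simp add: L2_norm_def)

lemma L2_norm_sq: "(L2_norm f)\<^sup>2 = L2_inner f f"
  by (simp add: L2_norm_def L2_inner_def power2_eq_square)

lemma L2_norm_sq_add:
  assumes "f \<in> L2" "g \<in> L2"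
  shows "(L2_norm (\<lambda>y. f y + g y))\<^sup>2 = (L2_norm f)\<^sup>2 + 2 * L2_inner f g + (L2_norm g)\<^sup>2"
  using assms
  by (simp add: L2_norm_sq L2_inner_add_left L2_inner_add_right L2_add L2_inner_commute[of g f])

lemma L2_norm_scale: "L2_norm (\<lambda>y. c * f y) = \<bar>c\<bar> * L2_norm f"
  by (simp add: L2_norm_def power_mult_distrib real_sqrt_mult)

lemma L2_Cauchy_Schwarz:
  assumes f: "f \<in> L2" and g: "g \<in> L2"
  shows "\<bar>L2_inner f g\<bar> \<le> L2_norm f * L2_norm g"
proof -
  define a b c where "a = (L2_norm f)\<^sup>2" and "b = L2_inner f g" and "c = (L2_norm g)\<^sup>2"
  \<comment> \<open>The quadratic polynomial in \<open>x\<close> whose discriminant gives the inequality.\<close>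
  have nn: "0 \<le> a + 2 * (x * b) + x\<^sup>2 * c" for x
  proof -
    have "0 \<le> (L2_norm (\<lambda>y. f y + x * g y))\<^sup>2" by simp
    also have "\<dots> = a + 2 * (x * b) + x\<^sup>2 * c"
      using L2_norm_sq_add[OF f L2_scale[OF g, of x]]
      by (simp add: L2_inner_scale_right L2_norm_scale power_mult_distrib a_def b_def c_def)
    finally show ?thesis .
  qed
  have "b\<^sup>2 \<le> a * c"
  proof (cases "c = 0")
    case True
    have "b = 0"
    proof (rule ccontr)
      assume "b \<noteq> 0"
      then show False using nn[of "- (a + 1) / (2 * b)"] True by (simp add: field_simps)
    qed
    then show ?thesis by (simp add: a_def c_def)
  next
    case False
    then have c: "c > 0" by (simp add: c_def)
    have "0 \<le> c * (a + 2 * ((- b / c) * b) + (- b / c)\<^sup>2 * c)"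
      using nn[of "- b / c"] c by (intro mult_nonneg_nonneg) auto
    also have "\<dots> = a * c - b\<^sup>2" using c by (simp add: field_simps power2_eq_square)
    finally show ?thesis by simp
  qed
  then have "\<bar>b\<bar>\<^sup>2 \<le> (L2_norm f * L2_norm g)\<^sup>2"
    by (simp add: a_def c_def power_mult_distrib)
  then show ?thesis unfolding b_def
    by (rule power2_le_imp_le) (simp add: L2_norm_nonneg)
qed

lemma L2_norm_triangle:
  assumes f: "f \<in> L2" and g: "g \<in> L2"
  shows "L2_norm (\<lambda>y. f y + g y) \<le> L2_norm f + L2_norm g"
proof (rule power2_le_imp_le)
  show "(L2_norm (\<lambda>y. f y + g y))\<^sup>2 \<le> (L2_norm f + L2_norm g)\<^sup>2"
    using L2_norm_sq_add[OF f g] L2_Cauchy_Schwarz[OF f g] by (simp add: power2_sum)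
qed (simp add: L2_norm_nonneg)

lemma L2_norm_triangle_rev:
  assumes "f \<in> L2" "g \<in> L2"
  shows "\<bar>L2_norm f - L2_norm g\<bar> \<le> L2_norm (\<lambda>y. f y - g y)"
proof -
  have "L2_norm (\<lambda>y. g y - f y) = L2_norm (\<lambda>y. f y - g y)"
    by (simp add: L2_norm_def power2_commute)
  then show ?thesis
    using L2_norm_triangle[OF L2_diff[OF assms] assms(2)]
      L2_norm_triangle[OF L2_diff[OF assms(2,1)] assms(1)] by simp
qed

lemma L2_norm_mono:
  assumes "f \<in> borel_measurable I01" "g \<in> L2" "\<And>y. y \<in> {0..1} \<Longrightarrow> \<bar>f y\<bar> \<le> \<bar>g y\<bar>"
  shows "f \<in> L2" "L2_norm f \<le> L2_norm g"
proof -
  have "integrable I01 (\<lambda>y. (f y)\<^sup>2)"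
    using assms by (intro Bochner_Integration.integrable_bound[OF L2_D(2)[OF assms(2)]])
      (auto simp: abs_le_square_iff)
  then show *: "f \<in> L2" using assms by (simp add: L2_def)
  show "L2_norm f \<le> L2_norm g" unfolding L2_norm_def
    using assms * by (intro real_sqrt_le_mono integral_mono)
      (auto simp: L2_def abs_le_square_iff)
qed

text \<open>
Dominated convergence for the squares.
\<close>

lemma L2_norm_tendsto_0:
  assumes meas: "\<And>m. h m \<in> borel_measurable I01" and G: "G \<in> L2"
    and bound: "\<And>m y. y \<in> {0..1} \<Longrightarrow> \<bar>h m y\<bar> \<le> \<bar>G y\<bar>"
    and lim: "AE y in I01. (\<lambda>m. h m y) \<longlonglongrightarrow> 0"
  shows "(\<lambda>m::nat. L2_norm (h m)) \<longlonglongrightarrow> 0"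
proof -
  have "(\<lambda>m. LINT y|I01. (h m y)\<^sup>2) \<longlonglongrightarrow> (LINT y|I01. 0)"
  proof (rule integral_dominated_convergence)
    show "integrable I01 (\<lambda>y. (G y)\<^sup>2)" using G by (simp add: L2_def)
    show "AE y in I01. (\<lambda>m. (h m y)\<^sup>2) \<longlonglongrightarrow> 0"
      using lim by eventually_elim (metis tendsto_null_power zero_less_numeral)
    show "AE y in I01. norm ((h m y)\<^sup>2) \<le> (G y)\<^sup>2" for m
      using bound by (intro AE_I2) (simp add: abs_le_square_iff)
  qed (use meas in auto)
  then show ?thesis
    unfolding L2_norm_def using tendsto_real_sqrt by fastforce
qed

lemma L2_inner_tendsto:
  assumes g: "g \<in> L2" and h: "h \<in> L2" "\<And>m. hm m \<in> L2"
    and lim: "(\<lambda>m::nat. L2_norm (\<lambda>y. hm m y - h y)) \<longlonglongrightarrow> 0"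
  shows "(\<lambda>m. L2_inner g (hm m)) \<longlonglongrightarrow> L2_inner g h"
proof -
  have "(\<lambda>m. L2_inner g (hm m) - L2_inner g h) \<longlonglongrightarrow> 0"
  proof (rule Lim_null_comparison)
    show "\<forall>\<^sub>F m in sequentially. norm (L2_inner g (hm m) - L2_inner g h)
        \<le> L2_norm g * L2_norm (\<lambda>y. hm m y - h y)"
      using L2_Cauchy_Schwarz[OF g L2_diff[OF h(2) h(1)]]
      by (simp add: L2_inner_diff_right[OF h(2) h(1) g])
    show "(\<lambda>m. L2_norm g * L2_norm (\<lambda>y. hm m y - h y)) \<longlonglongrightarrow> 0"
      using tendsto_mult_left[OF lim, of "L2_norm g"] by simp
  qed
  then show ?thesis using LIM_zero_iff by blast
qed

section \<open>Completeness of the cosines\<close>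

text \<open>
Truncate \<open>f\<close> at a high level; a bounded measurable function is an almost everywhere limit of
continuous functions, which may be truncated at the same level. Both approximations converge in
\<open>L2\<close> by dominated convergence.
\<close>

lemma L2_continuous_dense:
  assumes f: "f \<in> L2" and e: "e > 0"
  obtains g where "continuous_on UNIV g" "L2_norm (\<lambda>y. f y - g y) < e"
proof -
  define cl where "cl B x = max (- B) (min B x)" for B x :: real
  have fm: "f \<in> borel_measurable I01" using f by (simp add: L2_def)
  have clm [measurable]: "cl B \<in> borel_measurable borel" for B
    unfolding cl_def by measurable
  have "(\<lambda>m. L2_norm (\<lambda>y. f y - cl (real m) (f y))) \<longlonglongrightarrow> 0"
  proof (rule L2_norm_tendsto_0[OF _ f])
    show "(\<lambda>y. f y - cl (real m) (f y)) \<in> borel_measurable I01" for m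
      using fm by (auto intro!: borel_measurable_diff measurable_compose[OF fm])
    show "\<bar>f y - cl (real m) (f y)\<bar> \<le> \<bar>f y\<bar>" for m y by (simp add: cl_def max_def min_def)
    have "(\<lambda>m. f y - cl (real m) (f y)) \<longlonglongrightarrow> 0" for y
    proof (rule tendsto_eventually)
      obtain N where "\<bar>f y\<bar> \<le> real N" using real_arch_simple by blast
      then show "\<forall>\<^sub>F m in sequentially. f y - cl (real m) (f y) = 0"
        unfolding eventually_sequentially cl_def by (intro exI[of _ N]) (auto simp: max_def min_def)
    qed
    then show "AE y in I01. (\<lambda>m. f y - cl (real m) (f y)) \<longlonglongrightarrow> 0" by simp
  qed
  then have "\<forall>\<^sub>F m in sequentially. L2_norm (\<lambda>y. f y - cl (real m) (f y)) < e / 2"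
    using e by (intro order_tendstoD(2)) auto
  then obtain m where m: "L2_norm (\<lambda>y. f y - cl (real m) (f y)) < e / 2"
    by (auto simp: eventually_sequentially)
  define B where "B = real m"
  define fB where "fB y = cl B (f y)" for y
  have fBm: "fB \<in> borel_measurable I01"
    using fm by (auto simp: fB_def [abs_def] intro!: measurable_compose[OF fm])
  have cl_bd: "\<bar>cl B x\<bar> \<le> B" for x by (auto simp: cl_def B_def max_def min_def abs_le_iff)
  have fB: "fB \<in> L2"
    by (rule L2_bounded[OF fBm, of B]) (auto simp: fB_def cl_bd)
  have "f measurable_on {0..1}"
    using fm by (simp add: measurable_on_iff_borel_measurable)
  then obtain N g where N: "negligible N" and gc: "\<And>n. continuous_on UNIV (g n)"
    and glim: "\<And>x. x \<notin> N \<Longrightarrow> (\<lambda>n. g n x) \<longlonglongrightarrow> (if x \<in> {0..1} then f x else 0)"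
    unfolding measurable_on_def by metis
  have hc: "continuous_on S (\<lambda>y. cl B (g n y))" for n S
    unfolding cl_def by (intro continuous_intros continuous_on_subset[OF gc]) simp
  have "(\<lambda>n. L2_norm (\<lambda>y. fB y - cl B (g n y))) \<longlonglongrightarrow> 0"
  proof (rule L2_norm_tendsto_0)
    show "(\<lambda>y. fB y - cl B (g n y)) \<in> borel_measurable I01" for n
      using fBm continuous_borel_I01[OF hc] by simp
    show "(\<lambda>_. 2 * B) \<in> L2" by (rule L2_continuous) simp
    show "\<bar>fB y - cl B (g n y)\<bar> \<le> \<bar>2 * B\<bar>" for n y
      using cl_bd[of "f y"] cl_bd[of "g n y"] by (simp add: fB_def)
    have "AE y in I01. y \<notin> N"
      using AE_not_in[OF N[unfolded negligible_iff_null_sets]]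
      by (auto simp: AE_restrict_space_iff elim: eventually_mono)
    moreover have "(\<lambda>n. fB y - cl B (g n y)) \<longlonglongrightarrow> 0" if "y \<notin> N" "y \<in> {0..1}" for y
    proof -
      have "(\<lambda>n. g n y) \<longlonglongrightarrow> f y" using glim[OF that(1)] that(2) by simp
      then have "(\<lambda>n. cl B (f y) - cl B (g n y)) \<longlonglongrightarrow> cl B (f y) - cl B (f y)"
        unfolding cl_def by (intro tendsto_intros)
      then show ?thesis by (simp add: fB_def)
    qed
    ultimately show "AE y in I01. (\<lambda>n. fB y - cl B (g n y)) \<longlonglongrightarrow> 0"
      by (auto simp: AE_restrict_space_iff elim: eventually_mono)
  qed
  then have "\<forall>\<^sub>F n in sequentially. L2_norm (\<lambda>y. fB y - cl B (g n y)) < e / 2"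
    using e by (intro order_tendstoD(2)) auto
  then obtain n where n: "L2_norm (\<lambda>y. fB y - cl B (g n y)) < e / 2"
    by (auto simp: eventually_sequentially)
  have "L2_norm (\<lambda>y. (f y - fB y) + (fB y - cl B (g n y)))
      \<le> L2_norm (\<lambda>y. f y - fB y) + L2_norm (\<lambda>y. fB y - cl B (g n y))"
    by (intro L2_norm_triangle L2_diff f fB L2_continuous hc)
  also have "\<dots> < e" using m n by (simp add: fB_def B_def)
  finally show thesis by (intro that[of "\<lambda>y. cl B (g n y)"] hc) simp
qed

definition cosn :: "nat \<Rightarrow> real \<Rightarrow> real" where
  "cosn n y = cos (real n * pi * y)"

definition sinn :: "nat \<Rightarrow> real \<Rightarrow> real" where
  "sinn n y = sin (real n * pi * y)"

lemma continuous_cosn [continuous_intros]: "continuous_on S (cosn n)"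
  unfolding cosn_def [abs_def] by (intro continuous_intros)

lemma continuous_sinn [continuous_intros]: "continuous_on S (sinn n)"
  unfolding sinn_def [abs_def] by (intro continuous_intros)

lemma cosn_L2: "cosn n \<in> L2" and sinn_L2: "sinn n \<in> L2"
  by (auto intro: L2_continuous continuous_intros)

lemma cosn_mult: "cosn m y * cosn n y = 1/2 * cosn (m + n) y + 1/2 * cosn (max m n - min m n) y"
proof (cases "m \<le> n")
  case True
  have *: "real n * pi * y - real m * pi * y = real (n - m) * pi * y"
    using True by (simp add: of_nat_diff left_diff_distrib)
  show ?thesis using True cos_times_cos[of "real n * pi * y" "real m * pi * y"]
    unfolding * by (simp add: cosn_def max_def min_def algebra_simps add_divide_distrib)
next
  case False
  have *: "real m * pi * y - real n * pi * y = real (m - n) * pi * y"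
    using False by (simp add: of_nat_diff left_diff_distrib)
  show ?thesis using False cos_times_cos[of "real m * pi * y" "real n * pi * y"]
    unfolding * by (simp add: cosn_def max_def min_def algebra_simps add_divide_distrib)
qed

lemma integral_cosn: "(LINT y|I01. cosn n y) = (if n = 0 then 1 else 0)"
proof (cases "n = 0")
  case True
  have "(LINT y|I01. (1::real)) = integral {0..1::real} (\<lambda>y. 1)"
    by (intro lebesgue_integral_eq_integral continuous_imp_integrable_real) auto
  then show ?thesis using True by (simp add: cosn_def)
next
  case False
  define k where "k = real n * pi"
  have k: "k \<noteq> 0" using False by (simp add: k_def)
  have "((\<lambda>y. cos (k * y)) has_integral sin (k * 1) / k - sin (k * 0) / k) {0..1}"
    by (intro fundamental_theorem_of_calculus)
       (auto intro!: derivative_eq_intros simp: k has_real_derivative_iff_has_vector_derivative[symmetric])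
  moreover have "sin k = 0" by (simp add: k_def)
  ultimately have "integral {0..1} (\<lambda>y. cos (k * y)) = 0" by (auto intro: integral_unique)
  moreover have "(LINT y|I01. cosn n y) = integral {0..1} (cosn n)"
    by (intro lebesgue_integral_eq_integral continuous_imp_integrable_real) (auto intro: continuous_intros)
  ultimately show ?thesis using False by (simp add: cosn_def [abs_def] k_def)
qed

text \<open>
The reciprocal of the squared norm of \<open>cosn n\<close>.
\<close>

definition wt :: "nat \<Rightarrow> real" where
  "wt n = (if n = 0 then 1 else 2)"

lemma wt_pos: "wt n > 0" by (simp add: wt_def)

lemma cosn_orthogonal: "L2_inner (cosn m) (cosn n) = (if m = n then 1 / wt n else 0)"
proof -
  have i: "integrable I01 (cosn n)" for n
    by (rule continuous_imp_integrable_real) (rule continuous_intros)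
  have "L2_inner (cosn m) (cosn n)
      = 1/2 * (LINT y|I01. cosn (m + n) y) + 1/2 * (LINT y|I01. cosn (max m n - min m n) y)"
    unfolding L2_inner_def cosn_mult using i by simp
  then show ?thesis by (auto simp: integral_cosn wt_def max_def min_def split: if_splits)
qed

inductive cos_poly :: "(real \<Rightarrow> real) \<Rightarrow> bool" where
  monomial: "cos_poly (\<lambda>y. a * cosn n y)"
| add: "cos_poly f \<Longrightarrow> cos_poly g \<Longrightarrow> cos_poly (\<lambda>y. f y + g y)"

text \<open>
The product formula for cosines makes the cosine polynomials an algebra, as Stone-Weierstrass
requires.
\<close>

lemma cos_poly_mult:
  assumes "cos_poly f" "cos_poly g"
  shows "cos_poly (\<lambda>y. f y * g y)"
  using assms(1)
proof (induction rule: cos_poly.induct)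
  case (monomial a n)
  from assms(2) show ?case
  proof (induction rule: cos_poly.induct)
    case (monomial b m)
    have "cos_poly (\<lambda>y. (a * b / 2) * cosn (n + m) y + (a * b / 2) * cosn (max n m - min n m) y)"
      by (intro cos_poly.intros)
    moreover have "(a * cosn n y) * (b * cosn m y)
        = (a * b / 2) * cosn (n + m) y + (a * b / 2) * cosn (max n m - min n m) y" for y
    proof -
      have "(a * cosn n y) * (b * cosn m y) = (a * b) * (cosn n y * cosn m y)" by simp
      also have "\<dots> = (a * b / 2) * cosn (n + m) y + (a * b / 2) * cosn (max n m - min n m) y"
        unfolding cosn_mult by (simp add: algebra_simps)
      finally show ?thesis .
    qed
    ultimately show ?case by simp
  qed (simp add: distrib_left cos_poly.add)
qed (simp add: distrib_right cos_poly.add)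

lemma cos_poly_continuous: "cos_poly f \<Longrightarrow> continuous_on S f"
  by (induction rule: cos_poly.induct) (auto intro!: continuous_intros)

text \<open>
The single function \<open>cos (\<pi> y)\<close> separates the points of \<open>[0,1]\<close>, so Stone-Weierstrass applies.
\<close>

lemma cos_poly_dense:
  assumes f: "f \<in> L2" and e: "e > 0"
  obtains p where "cos_poly p" "L2_norm (\<lambda>y. f y - p y) < e"
proof -
  obtain g where g: "continuous_on UNIV g" "L2_norm (\<lambda>y. f y - g y) < e / 2"
    using L2_continuous_dense[OF f, of "e / 2"] e by auto
  have "\<exists>p. cos_poly p \<and> (\<forall>x\<in>{0..1}. \<bar>g x - p x\<bar> < e / 2)"
  proof (rule Stone_Weierstrass_HOL)
    show "cos_poly (\<lambda>x. c)" for c using cos_poly.monomial[of c 0] by (simp add: cosn_def)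
    show "\<exists>h. cos_poly h \<and> h x \<noteq> h y" if "x \<in> {0..1} \<and> y \<in> {0..1} \<and> x \<noteq> y" for x y :: real
    proof (intro exI conjI)
      show "cos_poly (\<lambda>y. 1 * cosn 1 y)" by (rule cos_poly.monomial)
      have "pi * x \<in> {0..pi}" "pi * y \<in> {0..pi}" "pi * x \<noteq> pi * y" using that by auto
      then show "1 * cosn 1 x \<noteq> 1 * cosn 1 y" by (auto simp: cosn_def mult.commute dest: cos_inj_pi)
    qed
  qed (use e g(1) in \<open>auto intro: cos_poly.add cos_poly_mult cos_poly_continuous continuous_on_subset\<close>)
  then obtain p where p: "cos_poly p" "\<And>x. x \<in> {0..1} \<Longrightarrow> \<bar>g x - p x\<bar> < e / 2" by auto
  have gL: "g \<in> L2" and pL: "p \<in> L2"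
    using g(1) p(1) by (auto intro: L2_continuous cos_poly_continuous continuous_on_subset)
  have "L2_norm (\<lambda>y. g y - p y) \<le> L2_norm (\<lambda>y. e / 2 * cosn 0 y)"
    using p(2) e gL pL by (intro L2_norm_mono(2)) (auto simp: cosn_def less_imp_le intro: L2_continuous L2_D L2_diff)
  also have "\<dots> = e / 2"
  proof -
    have "(L2_norm (cosn 0))\<^sup>2 = 1\<^sup>2" by (simp add: L2_norm_sq cosn_orthogonal wt_def)
    then have "L2_norm (cosn 0) = 1" using L2_norm_nonneg power2_eq_imp_eq by fastforce
    then show ?thesis using e by (subst L2_norm_scale) simp
  qed
  finally have "L2_norm (\<lambda>y. g y - p y) \<le> e / 2" .
  moreover have "L2_norm (\<lambda>y. (f y - g y) + (g y - p y)) \<le> L2_norm (\<lambda>y. f y - g y) + L2_norm (\<lambda>y. g y - p y)"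
    by (intro L2_norm_triangle L2_diff f gL pL)
  ultimately show thesis using g(2) p(1) by (intro that[of p]) auto
qed

text \<open>
Any bound on the frequencies in \<open>p\<close> is a possible \<open>N\<close>.
\<close>

lemma cos_poly_orthogonal:
  assumes "cos_poly p"
  shows "\<exists>N. \<forall>r\<in>L2. (\<forall>n\<le>N. L2_inner r (cosn n) = 0) \<longrightarrow> L2_inner r p = 0"
  using assms
proof (induction rule: cos_poly.induct)
  case (monomial a n)
  then show ?case by (intro exI[of _ n]) (simp add: L2_inner_scale_right)
next
  case (add f g)
  then obtain N1 N2 where
    "\<forall>r\<in>L2. (\<forall>n\<le>N1. L2_inner r (cosn n) = 0) \<longrightarrow> L2_inner r f = 0"
    "\<forall>r\<in>L2. (\<forall>n\<le>N2. L2_inner r (cosn n) = 0) \<longrightarrow> L2_inner r g = 0" by blast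
  moreover have "f \<in> L2" "g \<in> L2" using add by (auto intro: L2_continuous cos_poly_continuous)
  ultimately show ?case
    by (intro exI[of _ "max N1 N2"]) (auto simp: L2_inner_add_right)
qed

definition cos_partial :: "nat \<Rightarrow> (real \<Rightarrow> real) \<Rightarrow> real \<Rightarrow> real" where
  "cos_partial N f y = (\<Sum>n\<le>N. wt n * L2_inner f (cosn n) * cosn n y)"

lemma cos_partial_L2: "cos_partial N f \<in> L2"
  unfolding cos_partial_def [abs_def] by (intro L2_sum L2_scale cosn_L2)

lemma cos_partial_coeff:
  assumes "n \<le> N"
  shows "L2_inner (cos_partial N f) (cosn n) = L2_inner f (cosn n)"
proof -
  have "L2_inner (cosn n) (cos_partial N f) = (\<Sum>m\<le>N. L2_inner (cosn n) (\<lambda>y. wt m * L2_inner f (cosn m) * cosn m y))"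
    unfolding cos_partial_def [abs_def] by (intro L2_inner_sum_right L2_scale cosn_L2)
  also have "\<dots> = (\<Sum>m\<le>N. if m = n then L2_inner f (cosn n) else 0)"
    using wt_pos by (intro sum.cong) (auto simp: L2_inner_scale_right cosn_orthogonal less_imp_neq[symmetric])
  finally show ?thesis using assms by (simp add: L2_inner_commute)
qed

lemma cos_partial_inner:
  assumes "f \<in> L2" and g: "g \<in> L2"
  shows "L2_inner g (cos_partial N f) = (\<Sum>n\<le>N. wt n * L2_inner f (cosn n) * L2_inner g (cosn n))"
  unfolding cos_partial_def [abs_def]
  by (subst L2_inner_sum_right) (auto simp: g L2_inner_scale_right intro: L2_scale cosn_L2)

text \<open>
Pythagoras: the remainder of the partial sum is orthogonal to the partial sum.
\<close>

lemma cos_partial_remainder: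
  assumes f: "f \<in> L2"
  shows "(L2_norm f)\<^sup>2 = (\<Sum>n\<le>N. wt n * (L2_inner f (cosn n))\<^sup>2) + (L2_norm (\<lambda>y. f y - cos_partial N f y))\<^sup>2"
proof -
  let ?S = "cos_partial N f" and ?r = "\<lambda>y. f y - cos_partial N f y"
  have r: "?r \<in> L2" by (intro L2_diff f cos_partial_L2)
  have rc: "L2_inner ?r (cosn n) = 0" if "n \<le> N" for n
    using that by (simp add: L2_inner_diff_left f cos_partial_L2 cosn_L2 cos_partial_coeff)
  have "L2_inner ?S ?r = 0"
    using cos_partial_inner[OF f r, of N] rc by (simp add: L2_inner_commute)
  moreover have "(L2_norm ?S)\<^sup>2 = (\<Sum>n\<le>N. wt n * (L2_inner f (cosn n))\<^sup>2)"
    unfolding L2_norm_sq cos_partial_inner[OF f cos_partial_L2]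
    by (intro sum.cong) (auto simp: cos_partial_coeff power2_eq_square)
  ultimately show ?thesis using L2_norm_sq_add[OF cos_partial_L2 r, of N f] by simp
qed

lemma Bessel_cosn:
  assumes "f \<in> L2"
  shows "(\<Sum>n\<le>N. wt n * (L2_inner f (cosn n))\<^sup>2) \<le> (L2_norm f)\<^sup>2"
  using cos_partial_remainder[OF assms, of N] by simp

text \<open>
The partial sum is the best approximation among the cosine polynomials of degree at most \<open>N\<close>, and the
cosine polynomials are dense. Only this half of Parseval's identity serves to bound a norm by its coefficients.
\<close>

lemma Parseval_cosn:
  assumes f: "f \<in> L2" and bound: "\<And>N. (\<Sum>n\<le>N. wt n * (L2_inner f (cosn n))\<^sup>2) \<le> K"
  shows "(L2_norm f)\<^sup>2 \<le> K"
proof (rule field_le_epsilon)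
  fix e :: real assume "e > 0"
  then obtain p where p: "cos_poly p" and pn: "L2_norm (\<lambda>y. f y - p y) < sqrt e"
    using cos_poly_dense[OF f, of "sqrt e"] by auto
  obtain N where N: "\<And>r. r \<in> L2 \<Longrightarrow> (\<And>n. n \<le> N \<Longrightarrow> L2_inner r (cosn n) = 0) \<Longrightarrow> L2_inner r p = 0"
    using cos_poly_orthogonal[OF p] by metis
  let ?S = "cos_partial N f" and ?r = "\<lambda>y. f y - cos_partial N f y"
  have pL: "p \<in> L2" using p by (auto intro: L2_continuous cos_poly_continuous)
  have r: "?r \<in> L2" by (intro L2_diff f cos_partial_L2)
  have rc: "L2_inner ?r (cosn n) = 0" if "n \<le> N" for n
    using that by (simp add: L2_inner_diff_left f cos_partial_L2 cosn_L2 cos_partial_coeff)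
  have "L2_inner ?r ?S = 0" using cos_partial_inner[OF f r, of N] rc by simp
  moreover have "L2_inner ?r p = 0" using N r rc by blast
  ultimately have "L2_inner ?r (\<lambda>y. ?S y - p y) = 0"
    by (simp add: L2_inner_diff_right cos_partial_L2 pL r)
  then have "(L2_norm ?r)\<^sup>2 \<le> (L2_norm (\<lambda>y. f y - p y))\<^sup>2"
    using L2_norm_sq_add[OF r L2_diff[OF cos_partial_L2 pL], of N f] by simp
  also have "\<dots> \<le> (sqrt e)\<^sup>2" using pn by (intro power_mono) (auto simp: L2_norm_nonneg)
  finally have "(L2_norm ?r)\<^sup>2 \<le> e" using \<open>e > 0\<close> by simp
  then show "(L2_norm f)\<^sup>2 \<le> K + e"
    using cos_partial_remainder[OF f, of N] bound[of N] by linarith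
qed

section \<open>Smooth cutoff functions\<close>

definition smooth :: "(real \<Rightarrow> real) \<Rightarrow> bool" where
  "smooth f \<longleftrightarrow> (\<forall>k x. (deriv ^^ k) f field_differentiable at x)"

text \<open>
A set that is closed under derivatives consists of smooth functions. This replaces formulas for the
\<open>k\<close>-th derivative.
\<close>

lemma smooth_coinduct:
  assumes "f \<in> S" "\<And>h. h \<in> S \<Longrightarrow> \<exists>h'\<in>S. \<forall>x. (h has_real_derivative h' x) (at x)"
  shows "smooth f"
proof -
  have *: "(deriv ^^ k) f \<in> S" for k
  proof (induction k)
    case (Suc k)
    then obtain h' where "h' \<in> S" "\<forall>x. ((deriv ^^ k) f has_real_derivative h' x) (at x)"
      using assms(2) by blast
    moreover from this have "deriv ((deriv ^^ k) f) = h'" by (intro ext DERIV_imp_deriv) blast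
    ultimately show ?case by simp
  qed (use assms(1) in simp)
  show ?thesis unfolding smooth_def field_differentiable_def using *[THEN assms(2)] by blast
qed

lemma smooth_has_deriv: "smooth f \<Longrightarrow> (f has_real_derivative deriv f x) (at x)"
  unfolding smooth_def by (metis DERIV_deriv_iff_field_differentiable funpow_0)

lemma smooth_deriv: "smooth f \<Longrightarrow> smooth (deriv f)"
  unfolding smooth_def by (metis comp_apply funpow_Suc_right)

lemma smooth_deriv_iter: "smooth f \<Longrightarrow> smooth ((deriv ^^ k) f)"
  by (induction k) (auto intro: smooth_deriv)

lemma smooth_continuous: "smooth f \<Longrightarrow> continuous_on S f"
  by (meson DERIV_isCont continuous_at_imp_continuous_on smooth_has_deriv)

text \<open>
The derivative of a product is a sum of two products, so a set that contains products and is closed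
under derivatives must contain sums as well.
\<close>

inductive_set smooth_algebra :: "(real \<Rightarrow> real) set" where
  base: "smooth f \<Longrightarrow> f \<in> smooth_algebra"
| add: "f \<in> smooth_algebra \<Longrightarrow> g \<in> smooth_algebra \<Longrightarrow> (\<lambda>x. f x + g x) \<in> smooth_algebra"
| mult: "f \<in> smooth_algebra \<Longrightarrow> g \<in> smooth_algebra \<Longrightarrow> (\<lambda>x. f x * g x) \<in> smooth_algebra"

lemma smooth_mult:
  assumes "smooth f" "smooth g"
  shows "smooth (\<lambda>x. f x * g x)"
proof (rule smooth_coinduct)
  show "(\<lambda>x. f x * g x) \<in> smooth_algebra"
    using assms by (intro smooth_algebra.intros)
  show "\<exists>h'\<in>smooth_algebra. \<forall>x. (h has_real_derivative h' x) (at x)" if "h \<in> smooth_algebra" for h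
    using that
  proof (induction rule: smooth_algebra.induct)
    case (base f)
    then show ?case using smooth_has_deriv smooth_deriv smooth_algebra.base by blast
  next
    case (add f g)
    then obtain f' g' where "f' \<in> smooth_algebra" "\<forall>x. (f has_real_derivative f' x) (at x)"
      "g' \<in> smooth_algebra" "\<forall>x. (g has_real_derivative g' x) (at x)" by blast
    then show ?case
      by (intro bexI[of _ "\<lambda>x. f' x + g' x"]) (auto intro: DERIV_add smooth_algebra.add)
  next
    case (mult f g)
    then obtain f' g' where "f' \<in> smooth_algebra" "\<forall>x. (f has_real_derivative f' x) (at x)"
      "g' \<in> smooth_algebra" "\<forall>x. (g has_real_derivative g' x) (at x)" by blast
    with mult show ?case
      by (intro bexI[of _ "\<lambda>x. f' x * g x + g' x * f x"])
         (auto intro: DERIV_mult smooth_algebra.add smooth_algebra.mult)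
  qed
qed

lemma smooth_affine:
  assumes "smooth f"
  shows "smooth (\<lambda>x. f (c * x + d))"
proof (rule smooth_coinduct)
  let ?S = "{h. \<exists>k f. smooth f \<and> h = (\<lambda>x. k * f (c * x + d))}"
  show "(\<lambda>x. f (c * x + d)) \<in> ?S" using assms by (auto intro!: exI[of _ 1])
  show "\<exists>h'\<in>?S. \<forall>x. (h has_real_derivative h' x) (at x)" if h: "h \<in> ?S" for h
  proof -
    obtain k f where f: "smooth f" "h = (\<lambda>x. k * f (c * x + d))" using h by blast
    have "(h has_real_derivative (k * c) * deriv f (c * x + d)) (at x)" for x
      unfolding f(2)
      by (auto intro!: derivative_eq_intros DERIV_chain'[of "\<lambda>x. c * x + d" c x UNIV f] smooth_has_deriv f(1))
    then show ?thesis using smooth_deriv[OF f(1)]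
      by (intro bexI[of _ "\<lambda>x. (k * c) * deriv f (c * x + d)"]) auto
  qed
qed

lemma smooth_trig: "smooth (\<lambda>x. A * cos (k * x) + B * sin (k * x))"
proof (rule smooth_coinduct)
  let ?S = "{h. \<exists>A B. h = (\<lambda>x. A * cos (k * x) + B * sin (k * x))}"
  show "(\<lambda>x. A * cos (k * x) + B * sin (k * x)) \<in> ?S" by blast
  show "\<exists>h'\<in>?S. \<forall>x. (h has_real_derivative h' x) (at x)" if h: "h \<in> ?S" for h
  proof -
    obtain A B where f: "h = (\<lambda>x. A * cos (k * x) + B * sin (k * x))" using h by blast
    have "(h has_real_derivative (B * k) * cos (k * x) + (- A * k) * sin (k * x)) (at x)" for x
      unfolding f by (auto intro!: derivative_eq_intros)
    then show ?thesis
      by (intro bexI[of _ "\<lambda>x. (B * k) * cos (k * x) + (- A * k) * sin (k * x)"]) blast+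
  qed
qed

lemma smooth_cosn: "smooth (cosn n)"
  using smooth_trig[of 1 "real n * pi" 0] by (simp add: cosn_def [abs_def])

lemma smooth_sinn: "smooth (sinn n)"
  using smooth_trig[of 0 "real n * pi" 1] by (simp add: sinn_def [abs_def])

text \<open>
These functions are closed under derivatives: for \<open>z = 1/x\<close> the derivative of \<open>Q(z) e\<^sup>-\<^sup>z\<close> with respect
to \<open>x\<close> is \<open>z\<^sup>2 (Q(z) - Q'(z)) e\<^sup>-\<^sup>z\<close>.
\<close>

definition flat_exp_poly :: "real poly \<Rightarrow> real \<Rightarrow> real" where
  "flat_exp_poly Q x = (if x > 0 then poly Q (inverse x) * exp (- inverse x) else 0)"

lemma poly_exp_tendsto_0: "((\<lambda>z. poly Q z * exp (- z)) \<longlongrightarrow> 0) at_top" for Q :: "real poly"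
proof -
  have "((\<lambda>z. \<Sum>i\<le>degree Q. coeff Q i * (z ^ i / exp z)) \<longlongrightarrow> (\<Sum>i\<le>degree Q. coeff Q i * 0)) at_top"
    by (intro tendsto_intros tendsto_power_div_exp_0)
  then show ?thesis
    by (simp add: poly_altdef sum_distrib_right exp_minus divide_inverse mult.assoc)
qed

text \<open>
At \<open>0\<close> the difference quotient tends to \<open>0\<close> because the exponential beats every power of \<open>1/x\<close>.
\<close>

lemma flat_exp_poly_deriv:
  "(flat_exp_poly Q has_real_derivative flat_exp_poly ([:0, 0, 1:] * (Q - pderiv Q)) x) (at x)"
proof (cases x "0::real" rule: linorder_cases)
  case less
  have "\<forall>\<^sub>F y in nhds x. y < 0" using less by (intro order_tendstoD(2)) (auto intro: filterlim_ident)
  then have "\<forall>\<^sub>F y in nhds x. flat_exp_poly Q y = 0" by eventually_elim (simp add: flat_exp_poly_def)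
  then have "(flat_exp_poly Q has_real_derivative 0) (at x)"
    by (subst DERIV_cong_ev[OF refl _ refl, where g = "\<lambda>_. 0"]) auto
  then show ?thesis using less by (simp add: flat_exp_poly_def)
next
  case greater
  have "\<forall>\<^sub>F y in nhds x. y > 0" using greater by (intro order_tendstoD(1)) (auto intro: filterlim_ident)
  then have ev: "\<forall>\<^sub>F y in nhds x. flat_exp_poly Q y = poly Q (inverse y) * exp (- inverse y)"
    by eventually_elim (simp add: flat_exp_poly_def)
  have "((\<lambda>y. poly Q (inverse y) * exp (- inverse y)) has_real_derivative
      flat_exp_poly ([:0, 0, 1:] * (Q - pderiv Q)) x) (at x)"
    using greater
    by (auto intro!: derivative_eq_intros DERIV_chain'[of inverse _ x UNIV "poly Q"] poly_DERIV
        simp: flat_exp_poly_def algebra_simps power2_eq_square)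
  then show ?thesis by (subst DERIV_cong_ev[OF refl ev refl])
next
  case equal
  have "((\<lambda>h. flat_exp_poly Q h / h) \<longlongrightarrow> 0) (at_left 0)"
    by (rule tendsto_eventually) (auto simp: flat_exp_poly_def eventually_at_left_field intro!: exI[of _ "-1"])
  moreover have "((\<lambda>h. flat_exp_poly Q h / h) \<longlongrightarrow> 0) (at_right 0)"
  proof -
    have "((\<lambda>h. poly ([:0, 1:] * Q) (inverse h) * exp (- inverse h)) \<longlongrightarrow> 0) (at_right 0)"
      using filterlim_compose[OF poly_exp_tendsto_0 filterlim_inverse_at_top_right] .
    moreover have "\<forall>\<^sub>F h in at_right 0. poly ([:0, 1:] * Q) (inverse h) * exp (- inverse h) = flat_exp_poly Q h / h"
      by (auto simp: flat_exp_poly_def eventually_at_right_field divide_inverse intro!: exI[of _ 1])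
    ultimately show ?thesis by (rule Lim_transform_eventually)
  qed
  ultimately have "((\<lambda>h. flat_exp_poly Q h / h) \<longlongrightarrow> 0) (at 0)"
    by (rule filterlim_split_at)
  then show ?thesis using equal by (simp add: has_field_derivative_iff) (simp add: flat_exp_poly_def)
qed

text \<open>
It vanishes for \<open>x \<le> 0\<close> and tends to \<open>1\<close> at infinity, so that its rescalings approach a step
function without any normalisation.
\<close>

definition flat_exp :: "real \<Rightarrow> real" where
  "flat_exp x = (if x > 0 then exp (- inverse x) else 0)"

definition dflat_exp :: "real \<Rightarrow> real" where
  "dflat_exp x = (if x > 0 then (inverse x)\<^sup>2 * exp (- inverse x) else 0)"

lemma flat_exp_as_poly: "flat_exp = flat_exp_poly 1"
  by (auto simp: flat_exp_def flat_exp_poly_def)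

lemma smooth_flat_exp: "smooth flat_exp"
proof (rule smooth_coinduct)
  show "flat_exp \<in> range flat_exp_poly" by (auto simp: flat_exp_as_poly)
qed (use flat_exp_poly_deriv in blast)

lemma flat_exp_deriv: "(flat_exp has_real_derivative dflat_exp x) (at x)"
proof -
  have "flat_exp_poly ([:0, 0, 1:] * (1 - pderiv 1)) x = dflat_exp x"
    by (simp add: flat_exp_poly_def dflat_exp_def power2_eq_square)
  then show ?thesis using flat_exp_poly_deriv[of 1 x] by (simp only: flat_exp_as_poly)
qed

lemma flat_exp_nonneg: "0 \<le> flat_exp x" and flat_exp_le_1: "flat_exp x \<le> 1" and dflat_exp_nonneg: "0 \<le> dflat_exp x"
  by (auto simp: flat_exp_def dflat_exp_def)

lemma dflat_exp_scaled: "x > 1 \<Longrightarrow> x * dflat_exp (x - 1) = ((inverse (x - 1))\<^sup>2 + inverse (x - 1)) * exp (- inverse (x - 1))"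
proof -
  assume x: "x > 1"
  define z where "z = x - 1"
  have z: "z > 0" "x = z + 1" using x by (auto simp: z_def)
  have "x * (inverse z)\<^sup>2 = (inverse z)\<^sup>2 + inverse z"
    using z by (simp add: field_simps power2_eq_square)
  then show ?thesis using z by (simp add: dflat_exp_def mult.assoc[symmetric])
qed

text \<open>
The derivative of \<open>flat_exp\<close> decays like \<open>1/x\<^sup>2\<close>. The factor \<open>x\<close> turns into \<open>m (y - a)\<close> after rescaling by
\<open>m\<close>, so this is a bound on the rescaled derivatives that is uniform in \<open>m\<close>.
\<close>

lemma dflat_exp_scaled_bound:
  assumes "x \<ge> 0"
  shows "x * dflat_exp (x - 1) \<le> 2"
proof (cases "x > 1")
  case True
  define z where "z = inverse (x - 1)"
  have z: "z \<ge> 0" using True by (simp add: z_def)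
  have "z\<^sup>2 + z \<le> 2 * exp z"
    using exp_lower_Taylor_quadratic[OF z] z by (simp add: field_simps)
  then have "(z\<^sup>2 + z) * exp (- z) \<le> 2" by (simp add: exp_minus field_simps)
  then show ?thesis using dflat_exp_scaled[OF True] by (simp add: z_def)
qed (simp add: dflat_exp_def)

lemma flat_exp_tendsto: "c > 0 \<Longrightarrow> (\<lambda>m. flat_exp (real (Suc m) * c - 1)) \<longlonglongrightarrow> 1"
  and dflat_exp_tendsto: "c > 0 \<Longrightarrow> (\<lambda>m. real (Suc m) * c * dflat_exp (real (Suc m) * c - 1)) \<longlonglongrightarrow> 0"
proof -
  assume c: "c > 0"
  have lim: "filterlim (\<lambda>m. c * real (Suc m)) at_top sequentially"
    using c by (intro filterlim_tendsto_pos_mult_at_top[OF tendsto_const c]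
        filterlim_compose[OF filterlim_real_sequentially filterlim_Suc])
  then have lim1: "filterlim (\<lambda>m. real (Suc m) * c - 1) at_top sequentially"
    using filterlim_tendsto_add_at_top[OF tendsto_const[of "-1"] lim] by (simp add: mult.commute)
  have ev: "\<forall>\<^sub>F m in sequentially. real (Suc m) * c - 1 > 0"
    using lim1 unfolding filterlim_at_top_dense by blast
  have inv: "(\<lambda>m. inverse (real (Suc m) * c - 1)) \<longlonglongrightarrow> 0"
    using tendsto_inverse_0_at_top[OF lim1] .
  have "(\<lambda>m. exp (- inverse (real (Suc m) * c - 1))) \<longlonglongrightarrow> exp (- 0)"
    by (intro tendsto_intros inv)
  then have "(\<lambda>m. exp (- inverse (real (Suc m) * c - 1))) \<longlonglongrightarrow> 1" by simp
  then show "(\<lambda>m. flat_exp (real (Suc m) * c - 1)) \<longlonglongrightarrow> 1"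
    by (rule Lim_transform_eventually) (use ev in eventually_elim, simp add: flat_exp_def)
  have "(\<lambda>m. ((inverse (real (Suc m) * c - 1))\<^sup>2 + inverse (real (Suc m) * c - 1)) * exp (- inverse (real (Suc m) * c - 1)))
    \<longlonglongrightarrow> (0\<^sup>2 + 0) * exp (- 0)"
    by (intro tendsto_intros inv)
  then have "(\<lambda>m. ((inverse (real (Suc m) * c - 1))\<^sup>2 + inverse (real (Suc m) * c - 1)) * exp (- inverse (real (Suc m) * c - 1))) \<longlonglongrightarrow> 0" by simp
  then show "(\<lambda>m. real (Suc m) * c * dflat_exp (real (Suc m) * c - 1)) \<longlonglongrightarrow> 0"
  proof (rule Lim_transform_eventually)
    show "\<forall>\<^sub>F m in sequentially. ((inverse (real (Suc m) * c - 1))\<^sup>2 + inverse (real (Suc m) * c - 1)) * exp (- inverse (real (Suc m) * c - 1))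
      = real (Suc m) * c * dflat_exp (real (Suc m) * c - 1)"
      using ev by eventually_elim (subst dflat_exp_scaled, auto)
  qed
qed

text \<open>
A smooth function with support in \<open>[a + 1/(m+1), b - 1/(m+1)]\<close> that tends to \<open>1\<close> on \<open>(a,b)\<close>.
\<close>

definition cutoff :: "real \<Rightarrow> real \<Rightarrow> nat \<Rightarrow> real \<Rightarrow> real" where
  "cutoff a b m y = flat_exp (real (Suc m) * (y - a) - 1) * flat_exp (real (Suc m) * (b - y) - 1)"

definition dcutoff :: "real \<Rightarrow> real \<Rightarrow> nat \<Rightarrow> real \<Rightarrow> real" where
  "dcutoff a b m y =
     real (Suc m) * dflat_exp (real (Suc m) * (y - a) - 1) * flat_exp (real (Suc m) * (b - y) - 1)
   - real (Suc m) * dflat_exp (real (Suc m) * (b - y) - 1) * flat_exp (real (Suc m) * (y - a) - 1)"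

lemma smooth_cutoff: "smooth (cutoff a b m)"
proof -
  have "smooth (\<lambda>y. flat_exp (real (Suc m) * y + (- real (Suc m) * a - 1)) * flat_exp (- real (Suc m) * y + (real (Suc m) * b - 1)))"
    by (intro smooth_mult smooth_affine smooth_flat_exp)
  then show ?thesis by (simp add: cutoff_def [abs_def] algebra_simps)
qed

lemma flat_exp_left_deriv:
  "((\<lambda>y. flat_exp (real (Suc m) * (y - a) - 1)) has_real_derivative
     real (Suc m) * dflat_exp (real (Suc m) * (y - a) - 1)) (at y)"
proof -
  have "((\<lambda>y. real (Suc m) * (y - a) - 1) has_real_derivative real (Suc m)) (at y)"
    by (auto intro!: derivative_eq_intros)
  from DERIV_chain'[OF this flat_exp_deriv] show ?thesis by (simp only: mult.commute)
qed

lemma flat_exp_right_deriv: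
  "((\<lambda>y. flat_exp (real (Suc m) * (b - y) - 1)) has_real_derivative
     - (real (Suc m) * dflat_exp (real (Suc m) * (b - y) - 1))) (at y)"
proof -
  have "((\<lambda>y. real (Suc m) * (b - y) - 1) has_real_derivative - real (Suc m)) (at y)"
    by (auto intro!: derivative_eq_intros)
  from DERIV_chain'[OF this flat_exp_deriv] show ?thesis by (simp only: mult.commute mult_minus_left mult_minus_right)
qed

lemma cutoff_deriv: "(cutoff a b m has_real_derivative dcutoff a b m y) (at y)"
  using DERIV_mult[OF flat_exp_left_deriv[of m a y] flat_exp_right_deriv[of m b y]]
  by (simp add: cutoff_def [abs_def] dcutoff_def algebra_simps)

lemma deriv_cutoff: "deriv (cutoff a b m) = dcutoff a b m"
  using DERIV_imp_deriv[OF cutoff_deriv] by auto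

lemma continuous_cutoff [continuous_intros]: "continuous_on S (cutoff a b m)"
  by (rule smooth_continuous[OF smooth_cutoff])

lemma continuous_dcutoff [continuous_intros]: "continuous_on S (dcutoff a b m)"
  using smooth_continuous[OF smooth_deriv[OF smooth_cutoff]] by (metis deriv_cutoff)

lemma cutoff_nonneg: "0 \<le> cutoff a b m y" and cutoff_le_1: "cutoff a b m y \<le> 1"
  by (auto simp: cutoff_def flat_exp_nonneg flat_exp_le_1 mult_le_one)

lemma abs_cutoff_le_1: "\<bar>cutoff a b m y\<bar> \<le> 1"
  using cutoff_nonneg[of a b m y] cutoff_le_1[of a b m y] by simp

lemma cutoff_eq_0:
  assumes "y \<notin> {a + inverse (real (Suc m)) .. b - inverse (real (Suc m))}"
  shows "cutoff a b m y = 0"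
proof -
  have "real (Suc m) * (y - a) \<le> 1 \<or> real (Suc m) * (b - y) \<le> 1"
    using assms by (auto simp: field_simps)
  then show ?thesis by (auto simp: cutoff_def flat_exp_def)
qed

lemma dcutoff_eq_0:
  assumes "y \<notin> {a + inverse (real (Suc m)) .. b - inverse (real (Suc m))}"
  shows "dcutoff a b m y = 0"
proof -
  have "real (Suc m) * (y - a) \<le> 1 \<or> real (Suc m) * (b - y) \<le> 1"
    using assms by (auto simp: field_simps)
  then show ?thesis by (auto simp: dcutoff_def flat_exp_def dflat_exp_def)
qed

lemma cutoff_tendsto:
  assumes "a < y" "y < b"
  shows "(\<lambda>m. cutoff a b m y) \<longlonglongrightarrow> 1"
  using tendsto_mult[OF flat_exp_tendsto[of "y - a"] flat_exp_tendsto[of "b - y"]] assms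
  by (simp add: cutoff_def)

lemma dcutoff_weighted:
  "(y - a) * (b - y) * dcutoff a b m y =
     (b - y) * (real (Suc m) * (y - a) * dflat_exp (real (Suc m) * (y - a) - 1)) * flat_exp (real (Suc m) * (b - y) - 1)
   - (y - a) * (real (Suc m) * (b - y) * dflat_exp (real (Suc m) * (b - y) - 1)) * flat_exp (real (Suc m) * (y - a) - 1)"
  by (simp add: dcutoff_def algebra_simps)

lemma dcutoff_weighted_tendsto:
  assumes "a < y" "y < b"
  shows "(\<lambda>m. (y - a) * (b - y) * dcutoff a b m y) \<longlonglongrightarrow> 0"
proof -
  have "(\<lambda>m. (y - a) * (b - y) * dcutoff a b m y) \<longlonglongrightarrow> (b - y) * 0 * 1 - (y - a) * 0 * 1"
    unfolding dcutoff_weighted using assms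
    by (intro tendsto_intros flat_exp_tendsto dflat_exp_tendsto) auto
  then show ?thesis by simp
qed

lemma dcutoff_tendsto:
  assumes "a < y" "y < b"
  shows "(\<lambda>m. dcutoff a b m y) \<longlonglongrightarrow> 0"
  using tendsto_mult_left[OF dcutoff_weighted_tendsto[OF assms], of "inverse ((y - a) * (b - y))"] assms
  by simp

text \<open>
The derivative of the cutoff is of size \<open>m\<close> only at distance of order \<open>1/m\<close> from an end point. A factor
that vanishes at both ends therefore keeps it bounded.
\<close>

lemma dcutoff_weighted_bound:
  assumes y: "a \<le> y" "y \<le> b"
  shows "(y - a) * (b - y) * \<bar>dcutoff a b m y\<bar> \<le> 2 * (b - a)"
proof -
  have *: "0 \<le> c * (real (Suc m) * d * dflat_exp (real (Suc m) * d - 1)) * flat_exp z \<and>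
    c * (real (Suc m) * d * dflat_exp (real (Suc m) * d - 1)) * flat_exp z \<le> 2 * c"
    if "c \<ge> 0" "d \<ge> 0" for c d z
  proof -
    have 1: "0 \<le> real (Suc m) * d * dflat_exp (real (Suc m) * d - 1)"
      using that dflat_exp_nonneg by simp
    have 2: "real (Suc m) * d * dflat_exp (real (Suc m) * d - 1) \<le> 2"
      using that by (intro dflat_exp_scaled_bound) simp
    have "c * (real (Suc m) * d * dflat_exp (real (Suc m) * d - 1)) * flat_exp z \<le> c * 2 * 1"
      using 1 2 that flat_exp_le_1 flat_exp_nonneg by (intro mult_mono) auto
    then show ?thesis using 1 that flat_exp_nonneg by simp
  qed
  have "\<bar>(y - a) * (b - y) * dcutoff a b m y\<bar> \<le> 2 * (b - y) + 2 * (y - a)"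
    unfolding dcutoff_weighted
    using *[of "b - y" "y - a" "real (Suc m) * (b - y) - 1"] *[of "y - a" "b - y" "real (Suc m) * (y - a) - 1"] y
    by linarith
  then show ?thesis using y by (simp add: abs_mult)
qed

text \<open>
The cutoff rises once from \<open>0\<close> to at most \<open>1\<close> and falls once.
\<close>

lemma dcutoff_L1_bound:
  assumes "a < b"
  shows "integral {a..b} (\<lambda>y. \<bar>dcutoff a b m y\<bar>) \<le> 2"
proof -
  let ?l = "\<lambda>y. real (Suc m) * dflat_exp (real (Suc m) * (y - a) - 1)"
  let ?r = "\<lambda>y. real (Suc m) * dflat_exp (real (Suc m) * (b - y) - 1)"
  have l: "(?l has_integral flat_exp (real (Suc m) * (b - a) - 1) - flat_exp (real (Suc m) * (a - a) - 1)) {a..b}"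
    using assms flat_exp_left_deriv
    by (intro fundamental_theorem_of_calculus)
       (auto simp: has_real_derivative_iff_has_vector_derivative intro: has_vector_derivative_at_within)
  have "((\<lambda>y. - ?r y) has_integral flat_exp (real (Suc m) * (b - b) - 1) - flat_exp (real (Suc m) * (b - a) - 1)) {a..b}"
    using assms flat_exp_right_deriv
    by (intro fundamental_theorem_of_calculus)
       (auto simp: has_real_derivative_iff_has_vector_derivative intro: has_vector_derivative_at_within)
  from has_integral_neg[OF this]
  have r: "(?r has_integral flat_exp (real (Suc m) * (b - a) - 1) - flat_exp (real (Suc m) * (b - b) - 1)) {a..b}"
    by simp
  have "integral {a..b} (\<lambda>y. \<bar>dcutoff a b m y\<bar>) \<le> integral {a..b} (\<lambda>y. ?l y + ?r y)"
  proof (rule integral_le)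
    show "(\<lambda>y. \<bar>dcutoff a b m y\<bar>) integrable_on {a..b}"
      by (intro integrable_continuous_interval continuous_intros)
    show "(\<lambda>y. ?l y + ?r y) integrable_on {a..b}"
      using l r by (intro integrable_add) (auto simp: integrable_on_def)
    show "\<bar>dcutoff a b m y\<bar> \<le> ?l y + ?r y" for y
    proof -
      have "0 \<le> ?l y * flat_exp z \<and> ?l y * flat_exp z \<le> ?l y" "0 \<le> ?r y * flat_exp z \<and> ?r y * flat_exp z \<le> ?r y" for z
        using flat_exp_nonneg[of z] flat_exp_le_1[of z] dflat_exp_nonneg by (auto intro!: mult_right_le_one_le mult_nonneg_nonneg)
      then show ?thesis unfolding dcutoff_def by (smt (verit))
    qed
  qed
  also have "\<dots> = 2 * flat_exp (real (Suc m) * (b - a) - 1)"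
    using has_integral_add[OF l r] by (intro integral_unique) (simp add: flat_exp_def)
  also have "\<dots> \<le> 2" using flat_exp_le_1 by simp
  finally show ?thesis .
qed

lemma AE_Icc_interior: "AE y in lebesgue_on {a..b::real}. a < y \<and> y < b"
proof -
  have "AE y in lebesgue. y \<notin> {a, b}"
    by (intro AE_not_in) (simp add: negligible_iff_null_sets[symmetric])
  then have "AE y in lebesgue. y \<in> {a..b} \<longrightarrow> a < y \<and> y < b"
    by eventually_elim force
  then show ?thesis by (subst AE_restrict_space_iff) (simp, assumption)
qed

lemma cutoff_integral_tendsto:
  assumes "continuous_on {a..b} f"
  shows "(\<lambda>m. integral {a..b} (\<lambda>y. cutoff a b m y * f y)) \<longlonglongrightarrow> integral {a..b} f"
proof -
  have c: "continuous_on {a..b} (\<lambda>y. cutoff a b m y * f y)" for m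
    using assms by (intro continuous_intros)
  have "(\<lambda>m. LINT y|lebesgue_on {a..b}. cutoff a b m y * f y) \<longlonglongrightarrow> (LINT y|lebesgue_on {a..b}. f y)"
  proof (rule integral_dominated_convergence)
    show "integrable (lebesgue_on {a..b}) (\<lambda>y. \<bar>f y\<bar>)"
      using assms by (intro continuous_imp_integrable_real continuous_intros)
    show "AE y in lebesgue_on {a..b}. (\<lambda>m. cutoff a b m y * f y) \<longlonglongrightarrow> f y"
      using AE_Icc_interior by eventually_elim (use tendsto_mult_right[OF cutoff_tendsto] in fastforce)
    show "AE y in lebesgue_on {a..b}. norm (cutoff a b m y * f y) \<le> \<bar>f y\<bar>" for m
      using abs_cutoff_le_1 by (intro AE_I2) (simp add: abs_mult mult_left_le_one_le)
  qed (use c assms in \<open>auto intro!: borel_measurable_integrable continuous_imp_integrable_real\<close>)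
  then show ?thesis
    using c assms by (simp add: lebesgue_integral_eq_integral continuous_imp_integrable_real)
qed

text \<open>
For a polynomial this is integration by parts, since the cutoff vanishes at both ends. Polynomials
approximate \<open>f\<close> uniformly, and the derivatives of the cutoffs are bounded in \<open>L\<^sup>1\<close>.
\<close>

lemma dcutoff_integral_tendsto:
  assumes ab: "a < b" and f: "continuous_on {a..b} f"
  shows "(\<lambda>m. integral {a..b} (\<lambda>y. dcutoff a b m y * f y)) \<longlonglongrightarrow> f a - f b"
proof (rule LIMSEQ_I)
  fix e :: real assume "e > 0"
  \<comment> \<open>Two parts for the integral of \<open>f - p\<close>, two for its values at the ends, one for the polynomial.\<close>
  define d where "d = e / 6"
  have d: "d > 0" using \<open>e > 0\<close> by (simp add: d_def)
  obtain p where p: "real_polynomial_function p" "\<And>x. x \<in> {a..b} \<Longrightarrow> \<bar>f x - p x\<bar> < d"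
    using Stone_Weierstrass_real_polynomial_function[OF compact_Icc f d] by metis
  obtain p' where p': "real_polynomial_function p'" "\<And>x. (p has_real_derivative p' x) (at x)"
    using has_real_derivative_polynomial_function[OF p(1)] by blast
  have cp: "continuous_on S p" "continuous_on S p'" for S
    using p(1) p'(1) by (auto intro: continuous_on_polymonial_function simp: real_polynomial_function_eq)
  have ibp: "integral {a..b} (\<lambda>y. dcutoff a b m y * p y) = - integral {a..b} (\<lambda>y. cutoff a b m y * p' y)" for m
  proof -
    have "((\<lambda>y. dcutoff a b m y * p y + p' y * cutoff a b m y) has_integral
        cutoff a b m b * p b - cutoff a b m a * p a) {a..b}"
      using ab DERIV_mult[OF cutoff_deriv p'(2)]
      by (intro fundamental_theorem_of_calculus)
         (auto simp: has_real_derivative_iff_has_vector_derivative intro: has_vector_derivative_at_within)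
    then have "integral {a..b} (\<lambda>y. dcutoff a b m y * p y + cutoff a b m y * p' y) = 0"
      by (simp add: cutoff_eq_0 integral_unique mult.commute)
    then show ?thesis
      by (subst (asm) integral_add) (auto intro!: integrable_continuous_interval continuous_intros cp)
  qed
  have "integral {a..b} p' = p b - p a"
    using ab p'(2)
    by (intro integral_unique fundamental_theorem_of_calculus)
       (auto simp: has_real_derivative_iff_has_vector_derivative intro: has_vector_derivative_at_within)
  then have "(\<lambda>m. integral {a..b} (\<lambda>y. dcutoff a b m y * p y)) \<longlonglongrightarrow> - (p b - p a)"
    unfolding ibp using tendsto_minus[OF cutoff_integral_tendsto[OF cp(2)]] by metis
  then have "\<exists>N. \<forall>m\<ge>N. norm (integral {a..b} (\<lambda>y. dcutoff a b m y * p y) - - (p b - p a)) < d"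
    using d by (intro LIMSEQ_D)
  then obtain N where N: "\<And>m. m \<ge> N \<Longrightarrow> \<bar>integral {a..b} (\<lambda>y. dcutoff a b m y * p y) - (p a - p b)\<bar> < d"
    by auto
  have "norm (integral {a..b} (\<lambda>y. dcutoff a b m y * f y) - (f a - f b)) < e" if "m \<ge> N" for m
  proof -
    have "integral {a..b} (\<lambda>y. dcutoff a b m y * f y) - integral {a..b} (\<lambda>y. dcutoff a b m y * p y)
        = integral {a..b} (\<lambda>y. dcutoff a b m y * (f y - p y))"
      unfolding right_diff_distrib
      by (subst integral_diff) (auto intro!: integrable_continuous_interval continuous_intros cp f)
    moreover have "norm (integral {a..b} (\<lambda>y. dcutoff a b m y * (f y - p y)))
        \<le> integral {a..b} (\<lambda>y. d * \<bar>dcutoff a b m y\<bar>)"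
    proof (rule integral_norm_bound_integral)
      show "norm (dcutoff a b m y * (f y - p y)) \<le> d * \<bar>dcutoff a b m y\<bar>" if "y \<in> {a..b}" for y
        using p(2)[OF that] by (simp add: abs_mult mult.commute mult_mono)
    qed (auto intro!: integrable_continuous_interval continuous_intros cp f)
    moreover have "\<dots> \<le> d * 2"
      using dcutoff_L1_bound[OF ab, of m] d by simp
    moreover have "\<bar>f a - p a\<bar> < d" "\<bar>f b - p b\<bar> < d" using p(2) ab by auto
    ultimately show ?thesis using N[OF that] unfolding d_def real_norm_def by linarith
  qed
  then show "\<exists>N. \<forall>m\<ge>N. norm (integral {a..b} (\<lambda>y. dcutoff a b m y * f y) - (f a - f b)) < e" by blast
qed

lemma smooth_cutoff_test_fun:
  assumes "smooth f"
  shows "test_fun (\<lambda>y. cutoff 0 1 m y * f y)"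
proof -
  have "smooth (\<lambda>y. cutoff 0 1 m y * f y)" by (intro smooth_mult smooth_cutoff assms)
  moreover have "{0 + inverse (real (Suc m)) .. 1 - inverse (real (Suc m))} \<subseteq> {0<..<1}"
    by (auto simp del: of_nat_Suc) (smt (verit) inverse_positive_iff_positive of_nat_0_less_iff zero_less_Suc)+
  ultimately show ?thesis unfolding test_fun_def smooth_def
    using cutoff_eq_0[of _ 0 m 1] by (auto intro!: exI[of _ "{0 + inverse (real (Suc m)) .. 1 - inverse (real (Suc m))}"])
qed

section \<open>Weak derivatives tested against sines and cosines\<close>

lemma test_fun_smooth: "test_fun \<phi> \<Longrightarrow> smooth \<phi>"
  by (simp add: test_fun_def smooth_def)

lemma smooth_L2: "smooth \<phi> \<Longrightarrow> \<phi> \<in> L2"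
  by (intro L2_continuous smooth_continuous)

lemma test_fun_L2: "test_fun \<phi> \<Longrightarrow> \<phi> \<in> L2"
  by (intro smooth_L2 test_fun_smooth)

lemma test_fun_deriv:
  assumes "test_fun \<phi>"
  shows "test_fun (deriv \<phi>)"
proof -
  obtain K where K: "compact K" "K \<subseteq> {0<..<1}" "\<And>x. x \<notin> K \<Longrightarrow> \<phi> x = 0"
    using assms unfolding test_fun_def by blast
  have "deriv \<phi> x = 0" if "x \<notin> K" for x
  proof -
    have "\<forall>\<^sub>F y in nhds x. \<phi> y = 0"
      using K(1,3) that by (intro eventually_nhds[THEN iffD2] exI[of _ "- K"])
        (auto simp: compact_imp_closed open_Compl)
    then have "(\<phi> has_real_derivative 0) (at x)"
      by (subst DERIV_cong_ev[OF refl _ refl, where g = "\<lambda>_. 0"]) auto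
    then show ?thesis by (rule DERIV_imp_deriv)
  qed
  then show ?thesis
    using K smooth_deriv[OF test_fun_smooth[OF assms]] unfolding test_fun_def smooth_def by blast
qed

lemma weak_deriv_inner:
  "weak_deriv f g \<Longrightarrow> test_fun \<phi> \<Longrightarrow> L2_inner f (deriv \<phi>) = - L2_inner g \<phi>"
  by (simp add: weak_deriv_def L2_inner_def)

lemma H1_L2: "f \<in> H1 \<Longrightarrow> f \<in> L2"
  by (simp add: H1_def)

lemma Dy_L2: "f \<in> H1 \<Longrightarrow> Dy f \<in> L2"
  and Dy_weak_deriv: "f \<in> H1 \<Longrightarrow> weak_deriv f (Dy f)"
proof -
  assume "f \<in> H1"
  then have "\<exists>g. g \<in> L2 \<and> weak_deriv f g" by (auto simp: H1_def)
  from someI_ex[OF this] show "Dy f \<in> L2" "weak_deriv f (Dy f)" by (auto simp: Dy_def)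
qed

lemma cutoff_mult_L2_tendsto:
  assumes h: "continuous_on {0..1} h"
  shows "(\<lambda>m. L2_norm (\<lambda>y. cutoff 0 1 m y * h y - h y)) \<longlonglongrightarrow> 0"
proof (rule L2_norm_tendsto_0)
  show "(\<lambda>y. cutoff 0 1 m y * h y - h y) \<in> borel_measurable I01" for m
    by (intro continuous_borel_I01 continuous_intros h)
  show "h \<in> L2" by (rule L2_continuous[OF h])
  show "\<bar>cutoff 0 1 m y * h y - h y\<bar> \<le> \<bar>h y\<bar>" for m y
  proof -
    have "\<bar>(1 - cutoff 0 1 m y) * h y\<bar> \<le> 1 * \<bar>h y\<bar>"
      unfolding abs_mult using cutoff_nonneg[of 0 1 m y] cutoff_le_1[of 0 1 m y]
      by (intro mult_right_mono) auto
    then show ?thesis by (simp add: algebra_simps abs_minus_commute)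
  qed
  show "AE y in I01. (\<lambda>m. cutoff 0 1 m y * h y - h y) \<longlonglongrightarrow> 0"
    using AE_Icc_interior
  proof eventually_elim
    case (elim y)
    have "(\<lambda>m. cutoff 0 1 m y * h y - h y) \<longlonglongrightarrow> 1 * h y - h y"
      using elim by (intro tendsto_intros cutoff_tendsto) auto
    then show ?case by simp
  qed
qed

text \<open>
Sines and cosines are not test functions; their products with cutoffs are.
\<close>

definition cut_cos :: "nat \<Rightarrow> nat \<Rightarrow> real \<Rightarrow> real" where
  "cut_cos n m y = cutoff 0 1 m y * cosn n y"

definition cut_sin :: "nat \<Rightarrow> nat \<Rightarrow> real \<Rightarrow> real" where
  "cut_sin n m y = cutoff 0 1 m y * sinn n y"

lemma cut_cos_test_fun: "test_fun (cut_cos n m)"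
  unfolding cut_cos_def [abs_def] by (rule smooth_cutoff_test_fun[OF smooth_cosn])

lemma cut_sin_test_fun: "test_fun (cut_sin n m)"
  unfolding cut_sin_def [abs_def] by (rule smooth_cutoff_test_fun[OF smooth_sinn])

lemma cosn_deriv: "(cosn n has_real_derivative - (real n * pi * sinn n y)) (at y)"
  unfolding cosn_def [abs_def] sinn_def by (auto intro!: derivative_eq_intros)

lemma sinn_deriv: "(sinn n has_real_derivative real n * pi * cosn n y) (at y)"
  unfolding sinn_def [abs_def] cosn_def by (auto intro!: derivative_eq_intros)

lemma deriv_cut_cos:
  "deriv (cut_cos n m) = (\<lambda>y. dcutoff 0 1 m y * cosn n y - real n * pi * cut_sin n m y)"
proof
  fix y
  show "deriv (cut_cos n m) y = dcutoff 0 1 m y * cosn n y - real n * pi * cut_sin n m y"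
    unfolding cut_cos_def [abs_def] cut_sin_def
    using DERIV_mult[OF cutoff_deriv[of 0 1 m y] cosn_deriv[of n y]]
    by (intro DERIV_imp_deriv) (simp add: algebra_simps)
qed

lemma deriv_cut_sin:
  "deriv (cut_sin n m) = (\<lambda>y. dcutoff 0 1 m y * sinn n y + real n * pi * cut_cos n m y)"
proof
  fix y
  show "deriv (cut_sin n m) y = dcutoff 0 1 m y * sinn n y + real n * pi * cut_cos n m y"
    unfolding cut_cos_def cut_sin_def [abs_def]
    using DERIV_mult[OF cutoff_deriv[of 0 1 m y] sinn_deriv[of n y]]
    by (intro DERIV_imp_deriv) (simp add: algebra_simps)
qed

lemma cut_cos_L2_tendsto: "(\<lambda>m. L2_norm (\<lambda>y. cut_cos n m y - cosn n y)) \<longlonglongrightarrow> 0"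
  unfolding cut_cos_def by (intro cutoff_mult_L2_tendsto continuous_intros)

lemma cut_sin_L2_tendsto: "(\<lambda>m. L2_norm (\<lambda>y. cut_sin n m y - sinn n y)) \<longlonglongrightarrow> 0"
  unfolding cut_sin_def by (intro cutoff_mult_L2_tendsto continuous_intros)

text \<open>
The factor with zeros at both ends that \<open>dcutoff_weighted_bound\<close> asks for.
\<close>

lemma abs_sinn_le:
  assumes y: "0 \<le> y" "y \<le> 1"
  shows "\<bar>sinn n y\<bar> \<le> 2 * real n * pi * (y * (1 - y))"
proof -
  have 1: "\<bar>sinn n y\<bar> \<le> real n * pi * y"
    using abs_sin_x_le_abs_x[of "real n * pi * y"] y by (simp add: sinn_def)
  have "sin (real n * pi * (1 - y)) = - (cos (real n * pi) * sinn n y)"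
    by (simp add: right_diff_distrib sin_diff sinn_def)
  then have "\<bar>sinn n y\<bar> = \<bar>sin (real n * pi * (1 - y))\<bar>"
    by (simp add: abs_mult cos_npi)
  then have 2: "\<bar>sinn n y\<bar> \<le> real n * pi * (1 - y)"
    using abs_sin_x_le_abs_x[of "real n * pi * (1 - y)"] y by (simp add: abs_mult)
  show ?thesis
  proof (cases "y \<le> 1/2")
    case True
    have "y * 1 \<le> y * (2 * (1 - y))" using True y by (intro mult_left_mono) auto
    then have "real n * pi * y \<le> real n * pi * (2 * (y * (1 - y)))"
      by (intro mult_left_mono) (auto simp: algebra_simps)
    also have "\<dots> = 2 * real n * pi * (y * (1 - y))" by simp
    finally show ?thesis using 1 by linarith
  next
    case False
    have "(1 - y) * 1 \<le> (1 - y) * (2 * y)" using False y by (intro mult_left_mono) auto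
    then have "real n * pi * (1 - y) \<le> real n * pi * (2 * (y * (1 - y)))"
      by (intro mult_left_mono) (auto simp: algebra_simps)
    also have "\<dots> = 2 * real n * pi * (y * (1 - y))" by simp
    finally show ?thesis using 2 by linarith
  qed
qed

text \<open>
The sine belongs to \<open>H\<^sup>1\<^sub>0\<close>: it vanishes linearly at the ends, where the derivative of the cutoff is
large, so that the product with this derivative is bounded and tends to \<open>0\<close>.
\<close>

lemma deriv_cut_sin_L2_tendsto:
  "(\<lambda>m. L2_norm (\<lambda>y. deriv (cut_sin n m) y - real n * pi * cosn n y)) \<longlonglongrightarrow> 0"
proof (rule L2_norm_tendsto_0)
  let ?k = "real n * pi"
  show "(\<lambda>y. deriv (cut_sin n m) y - ?k * cosn n y) \<in> borel_measurable I01" for m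
    unfolding deriv_cut_sin cut_cos_def by (intro continuous_borel_I01 continuous_intros)
  show "(\<lambda>_. 5 * ?k) \<in> L2" by (intro L2_continuous) simp
  show "\<bar>deriv (cut_sin n m) y - ?k * cosn n y\<bar> \<le> \<bar>5 * ?k\<bar>" if "y \<in> {0..1}" for m y
  proof -
    have "\<bar>dcutoff 0 1 m y * sinn n y\<bar> \<le> \<bar>dcutoff 0 1 m y\<bar> * (2 * ?k * (y * (1 - y)))"
      unfolding abs_mult using abs_sinn_le[of y n] that by (intro mult_left_mono) auto
    also have "\<dots> = 2 * ?k * (y * (1 - y) * \<bar>dcutoff 0 1 m y\<bar>)" by simp
    also have "\<dots> \<le> 2 * ?k * 2"
      using dcutoff_weighted_bound[of 0 y 1 m] that by (intro mult_left_mono) auto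
    finally have 1: "\<bar>dcutoff 0 1 m y * sinn n y\<bar> \<le> 4 * ?k" by simp
    have "\<bar>(cutoff 0 1 m y - 1) * cosn n y\<bar> \<le> 1 * 1"
      unfolding abs_mult using cutoff_nonneg[of 0 1 m y] cutoff_le_1[of 0 1 m y]
      by (intro mult_mono) (auto simp: cosn_def)
    then have "?k * \<bar>(cutoff 0 1 m y - 1) * cosn n y\<bar> \<le> ?k * 1"
      by (intro mult_left_mono) auto
    then have 2: "\<bar>?k * ((cutoff 0 1 m y - 1) * cosn n y)\<bar> \<le> ?k"
      by (simp add: abs_mult)
    have "deriv (cut_sin n m) y - ?k * cosn n y
        = dcutoff 0 1 m y * sinn n y + ?k * ((cutoff 0 1 m y - 1) * cosn n y)"
      by (simp add: deriv_cut_sin cut_cos_def algebra_simps)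
    then show ?thesis using 1 2 by linarith
  qed
  show "AE y in I01. (\<lambda>m. deriv (cut_sin n m) y - ?k * cosn n y) \<longlonglongrightarrow> 0"
    using AE_Icc_interior
  proof eventually_elim
    case (elim y)
    have "(\<lambda>m. dcutoff 0 1 m y * sinn n y + ?k * (cutoff 0 1 m y * cosn n y) - ?k * cosn n y)
        \<longlonglongrightarrow> 0 * sinn n y + ?k * (1 * cosn n y) - ?k * cosn n y"
      using elim by (intro tendsto_intros cutoff_tendsto dcutoff_tendsto) auto
    then show ?case by (simp add: deriv_cut_sin cut_cos_def)
  qed
qed

text \<open>
Integration by parts. The cosine does not vanish at the ends, but the continuous representative of
\<open>f\<close> does, and so the boundary terms in \<open>dcutoff_integral_tendsto\<close> are zero. For \<open>n = 0\<close> it says that the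
weak derivative has mean zero.
\<close>

lemma inner_Dy_cosn:
  assumes f: "f \<in> H1" and zb: "zero_boundary f"
  shows "L2_inner (Dy f) (cosn n) = real n * pi * L2_inner f (sinn n)"
proof -
  let ?k = "real n * pi"
  have fL: "f \<in> L2" by (rule H1_L2[OF f])
  obtain v where v: "continuous_on {0..1} v" "AE y in I01. v y = f y" "v 0 = 0" "v 1 = 0"
    using zb unfolding zero_boundary_def by blast
  have dL: "(\<lambda>y. dcutoff 0 1 m y * cosn n y) \<in> L2" for m
    by (intro L2_continuous continuous_intros)
  have sL: "cut_sin n m \<in> L2" for m by (intro test_fun_L2 cut_sin_test_fun)
  have cL: "cut_cos n m \<in> L2" for m by (intro test_fun_L2 cut_cos_test_fun)
  have vc: "continuous_on {0..1} (\<lambda>y. dcutoff 0 1 m y * (v y * cosn n y))" for m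
    by (intro continuous_intros v)
  have "L2_inner f (\<lambda>y. dcutoff 0 1 m y * cosn n y)
      = integral {0..1} (\<lambda>y. dcutoff 0 1 m y * (v y * cosn n y))" for m
  proof -
    have "L2_inner f (\<lambda>y. dcutoff 0 1 m y * cosn n y) = (LINT y|I01. dcutoff 0 1 m y * (v y * cosn n y))"
      unfolding L2_inner_def
    proof (rule integral_cong_AE)
      show "(\<lambda>y. f y * (dcutoff 0 1 m y * cosn n y)) \<in> borel_measurable I01"
        using L2_mult_integrable[OF fL dL] by blast
      show "(\<lambda>y. dcutoff 0 1 m y * (v y * cosn n y)) \<in> borel_measurable I01"
        by (rule continuous_borel_I01[OF vc])
      show "AE y in I01. f y * (dcutoff 0 1 m y * cosn n y) = dcutoff 0 1 m y * (v y * cosn n y)"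
        using v(2) by eventually_elim (simp add: ac_simps)
    qed
    also have "\<dots> = integral {0..1} (\<lambda>y. dcutoff 0 1 m y * (v y * cosn n y))"
      using vc by (simp add: lebesgue_integral_eq_integral continuous_imp_integrable_real)
    finally show ?thesis .
  qed
  moreover have "(\<lambda>m. integral {0..1} (\<lambda>y. dcutoff 0 1 m y * (v y * cosn n y)))
      \<longlonglongrightarrow> v 0 * cosn n 0 - v 1 * cosn n 1"
    by (intro dcutoff_integral_tendsto continuous_intros v) simp
  ultimately have 1: "(\<lambda>m. L2_inner f (\<lambda>y. dcutoff 0 1 m y * cosn n y)) \<longlonglongrightarrow> 0"
    using v by simp
  have 2: "(\<lambda>m. L2_inner f (cut_sin n m)) \<longlonglongrightarrow> L2_inner f (sinn n)"
    by (intro L2_inner_tendsto fL sinn_L2 sL cut_sin_L2_tendsto)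
  have "L2_inner f (deriv (cut_cos n m))
      = L2_inner f (\<lambda>y. dcutoff 0 1 m y * cosn n y) - ?k * L2_inner f (cut_sin n m)" for m
    unfolding deriv_cut_cos by (simp add: L2_inner_diff_right fL dL sL L2_scale L2_inner_scale_right)
  then have lim1: "(\<lambda>m. L2_inner f (deriv (cut_cos n m))) \<longlonglongrightarrow> 0 - ?k * L2_inner f (sinn n)"
    using tendsto_diff[OF 1 tendsto_mult_left[OF 2, of ?k]] by simp
  have "(\<lambda>m. - L2_inner (Dy f) (cut_cos n m)) \<longlonglongrightarrow> - L2_inner (Dy f) (cosn n)"
    by (intro tendsto_minus L2_inner_tendsto Dy_L2[OF f] cosn_L2 cL cut_cos_L2_tendsto)
  moreover have "L2_inner f (deriv (cut_cos n m)) = - L2_inner (Dy f) (cut_cos n m)" for m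
    by (rule weak_deriv_inner[OF Dy_weak_deriv[OF f] cut_cos_test_fun])
  ultimately have "(\<lambda>m. L2_inner f (deriv (cut_cos n m))) \<longlonglongrightarrow> - L2_inner (Dy f) (cosn n)"
    by simp
  from LIMSEQ_unique[OF lim1 this] show ?thesis by simp
qed

text \<open>
The difference of two weak derivatives is orthogonal to all test functions, hence in the limit to all
cosines.
\<close>

lemma weak_deriv_unique:
  assumes w: "weak_deriv f g1" "weak_deriv f g2" and g: "g1 \<in> L2" "g2 \<in> L2"
  shows "L2_norm (\<lambda>y. g1 y - g2 y) = 0"
proof -
  have d: "(\<lambda>y. g1 y - g2 y) \<in> L2" by (intro L2_diff g)
  have cL: "cut_cos n m \<in> L2" for n m by (intro test_fun_L2 cut_cos_test_fun)
  have "L2_inner (\<lambda>y. g1 y - g2 y) (cosn n) = 0" for n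
  proof -
    have *: "L2_inner (\<lambda>y. g1 y - g2 y) (cut_cos n m) = 0" for m
      using weak_deriv_inner[OF w(1) cut_cos_test_fun] weak_deriv_inner[OF w(2) cut_cos_test_fun]
      by (simp add: L2_inner_diff_left g cL)
    have "(\<lambda>m. L2_inner (\<lambda>y. g1 y - g2 y) (cut_cos n m)) \<longlonglongrightarrow> L2_inner (\<lambda>y. g1 y - g2 y) (cosn n)"
      by (intro L2_inner_tendsto d cosn_L2 cL cut_cos_L2_tendsto)
    then show ?thesis unfolding * by (simp add: LIMSEQ_const_iff)
  qed
  then have "(L2_norm (\<lambda>y. g1 y - g2 y))\<^sup>2 \<le> 0"
    by (intro Parseval_cosn d) simp
  then show ?thesis by simp
qed

lemma weak_deriv_diff:
  assumes w: "weak_deriv f1 g1" "weak_deriv f2 g2"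
    and L: "f1 \<in> L2" "f2 \<in> L2" "g1 \<in> L2" "g2 \<in> L2"
  shows "weak_deriv (\<lambda>y. f1 y - f2 y) (\<lambda>y. g1 y - g2 y)"
proof -
  have "L2_inner (\<lambda>y. f1 y - f2 y) (deriv \<phi>) = - L2_inner (\<lambda>y. g1 y - g2 y) \<phi>" if "test_fun \<phi>" for \<phi>
    using that w L by (simp add: L2_inner_diff_left weak_deriv_inner test_fun_L2 test_fun_deriv)
  then show ?thesis by (simp add: weak_deriv_def L2_inner_def)
qed

text \<open>
\<open>Dy\<close> is a choice among representatives, so it is linear only up to null sets, by uniqueness of the
weak derivative.
\<close>

lemma L2_norm_Dy_diff:
  assumes f: "f1 \<in> H1" and g: "f2 \<in> H1"
  shows "L2_norm (\<lambda>y. Dy f1 y - Dy f2 y) \<le> H1_norm (\<lambda>y. f1 y - f2 y)"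
    and "L2_norm (\<lambda>y. f1 y - f2 y) \<le> H1_norm (\<lambda>y. f1 y - f2 y)"
proof -
  let ?h = "\<lambda>y. f1 y - f2 y" and ?d = "\<lambda>y. Dy f1 y - Dy f2 y"
  have w: "weak_deriv ?h ?d"
    using f g by (intro weak_deriv_diff Dy_weak_deriv Dy_L2 H1_L2)
  have d: "?d \<in> L2" using f g by (intro L2_diff Dy_L2)
  have h: "?h \<in> H1" using w d L2_diff[OF H1_L2[OF f] H1_L2[OF g]] by (auto simp: H1_def)
  have "L2_norm (\<lambda>y. (?d y - Dy ?h y) + Dy ?h y) \<le> L2_norm (\<lambda>y. ?d y - Dy ?h y) + L2_norm (Dy ?h)"
    by (intro L2_norm_triangle L2_diff d Dy_L2[OF h])
  then have "L2_norm ?d \<le> L2_norm (Dy ?h)"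
    using weak_deriv_unique[OF w Dy_weak_deriv[OF h] d Dy_L2[OF h]] by simp
  moreover have "L2_norm (Dy ?h) \<le> H1_norm ?h" "L2_norm ?h \<le> H1_norm ?h"
    unfolding H1_norm_def by (intro real_le_rsqrt; simp)+
  ultimately show "L2_norm ?d \<le> H1_norm ?h" "L2_norm ?h \<le> H1_norm ?h" by auto
qed

section \<open>Functions of time with values in H1\<close>

lemma C_time_H1: "w \<in> C_time H1 H1_norm \<Longrightarrow> t \<ge> 0 \<Longrightarrow> w t \<in> H1"
  by (simp add: C_time_def)

lemma continuous_on_H1_dominated:
  fixes F :: "real \<Rightarrow> real"
  assumes w: "w \<in> C_time H1 H1_norm"
    and F: "\<And>s t. s \<ge> 0 \<Longrightarrow> t \<ge> 0 \<Longrightarrow> \<bar>F t - F s\<bar> \<le> B * H1_norm (\<lambda>y. w t y - w s y)"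
  shows "continuous_on {0..} F"
  unfolding continuous_on_def
proof
  fix s :: real assume s: "s \<in> {0..}"
  have "((\<lambda>t. H1_norm (\<lambda>y. w t y - w s y)) \<longlongrightarrow> 0) (at s within {0..})"
    using w s by (simp add: C_time_def)
  from tendsto_mult_left[OF this, of B]
  have "((\<lambda>t. B * H1_norm (\<lambda>y. w t y - w s y)) \<longlongrightarrow> 0) (at s within {0..})" by simp
  then have "((\<lambda>t. F t - F s) \<longlongrightarrow> 0) (at s within {0..})"
    by (rule Lim_null_comparison[rotated])
       (use F s in \<open>auto simp: eventually_at_filter intro!: always_eventually\<close>)
  then show "(F \<longlongrightarrow> F s) (at s within {0..})" by (rule LIM_zero_cancel)
qed

lemma C_time_inner_continuous:
  assumes w: "w \<in> C_time H1 H1_norm" and g: "g \<in> L2"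
  shows "continuous_on {0..} (\<lambda>t. L2_inner (w t) g)"
proof (rule continuous_on_H1_dominated[OF w])
  fix s t :: real assume "s \<ge> 0" "t \<ge> 0"
  then have H: "w t \<in> H1" "w s \<in> H1" using w by (auto intro: C_time_H1)
  have "\<bar>L2_inner (w t) g - L2_inner (w s) g\<bar> = \<bar>L2_inner (\<lambda>y. w t y - w s y) g\<bar>"
    using H g by (simp add: L2_inner_diff_left H1_L2)
  also have "\<dots> \<le> L2_norm (\<lambda>y. w t y - w s y) * L2_norm g"
    using H by (intro L2_Cauchy_Schwarz L2_diff g) (auto intro: H1_L2)
  also have "\<dots> \<le> L2_norm g * H1_norm (\<lambda>y. w t y - w s y)"
    using L2_norm_Dy_diff(2)[OF H] L2_norm_nonneg by (simp add: mult.commute mult_left_mono)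
  finally show "\<bar>L2_inner (w t) g - L2_inner (w s) g\<bar> \<le> L2_norm g * H1_norm (\<lambda>y. w t y - w s y)" .
qed

lemma C_time_bounded:
  assumes w: "w \<in> C_time H1 H1_norm"
  shows "\<exists>B. \<forall>r\<in>{0..T}. L2_norm (w r) \<le> B \<and> L2_norm (Dy (w r)) \<le> B"
proof -
  have "continuous_on {0..} (\<lambda>t. L2_norm (w t))"
  proof (rule continuous_on_H1_dominated[OF w, where B = 1])
    fix s t :: real assume "s \<ge> 0" "t \<ge> 0"
    then have H: "w t \<in> H1" "w s \<in> H1" using w by (auto intro: C_time_H1)
    show "\<bar>L2_norm (w t) - L2_norm (w s)\<bar> \<le> 1 * H1_norm (\<lambda>y. w t y - w s y)"
      using L2_norm_triangle_rev[OF H1_L2[OF H(1)] H1_L2[OF H(2)]] L2_norm_Dy_diff(2)[OF H] by simp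
  qed
  moreover have "continuous_on {0..} (\<lambda>t. L2_norm (Dy (w t)))"
  proof (rule continuous_on_H1_dominated[OF w, where B = 1])
    fix s t :: real assume "s \<ge> 0" "t \<ge> 0"
    then have H: "w t \<in> H1" "w s \<in> H1" using w by (auto intro: C_time_H1)
    show "\<bar>L2_norm (Dy (w t)) - L2_norm (Dy (w s))\<bar> \<le> 1 * H1_norm (\<lambda>y. w t y - w s y)"
      using L2_norm_triangle_rev[OF Dy_L2[OF H(1)] Dy_L2[OF H(2)]] L2_norm_Dy_diff(1)[OF H] by simp
  qed
  ultimately have "continuous_on {0..T} (\<lambda>t. L2_norm (w t) + L2_norm (Dy (w t)))"
    by (intro continuous_on_add) (auto intro: continuous_on_subset)
  then have "bounded ((\<lambda>t. L2_norm (w t) + L2_norm (Dy (w t))) ` {0..T})"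
    by (intro compact_imp_bounded compact_continuous_image compact_Icc)
  then obtain B where "\<And>r. r \<in> {0..T} \<Longrightarrow> \<bar>L2_norm (w r) + L2_norm (Dy (w r))\<bar> \<le> B"
    by (force simp: bounded_iff)
  then have "L2_norm (w r) \<le> B \<and> L2_norm (Dy (w r)) \<le> B" if "r \<in> {0..T}" for r
    using that L2_norm_nonneg[of "w r"] L2_norm_nonneg[of "Dy (w r)"] by force
  then show ?thesis by blast
qed

text \<open>
By Cauchy-Schwarz the inner products converge uniformly in time when the norms are bounded in time.
\<close>

lemma integral_inner_tendsto:
  fixes T :: real
  assumes w: "\<And>r. r \<in> {0..T} \<Longrightarrow> w r \<in> L2" "\<And>r. r \<in> {0..T} \<Longrightarrow> L2_norm (w r) \<le> B"
    and g: "g \<in> L2" "\<And>m. gm m \<in> L2" "(\<lambda>m::nat. L2_norm (\<lambda>y. gm m y - g y)) \<longlonglongrightarrow> 0"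
    and c: "\<And>m. continuous_on {0..T} (\<lambda>r. L2_inner (w r) (gm m))"
  shows "(\<lambda>m. integral {0..T} (\<lambda>r. L2_inner (w r) (gm m))) \<longlonglongrightarrow> integral {0..T} (\<lambda>r. L2_inner (w r) g)"
proof -
  have "uniform_limit {0..T} (\<lambda>m r. L2_inner (w r) (gm m)) (\<lambda>r. L2_inner (w r) g) sequentially"
  proof (rule uniform_limitI)
    fix e :: real assume "e > 0"
    have "(\<lambda>m. \<bar>B\<bar> * L2_norm (\<lambda>y. gm m y - g y)) \<longlonglongrightarrow> 0"
      using tendsto_mult_left[OF g(3), of "\<bar>B\<bar>"] by simp
    then have "\<forall>\<^sub>F m in sequentially. \<bar>B\<bar> * L2_norm (\<lambda>y. gm m y - g y) < e"
      using \<open>e > 0\<close> by (intro order_tendstoD(2)) auto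
    then show "\<forall>\<^sub>F m in sequentially. \<forall>r\<in>{0..T}. dist (L2_inner (w r) (gm m)) (L2_inner (w r) g) < e"
    proof eventually_elim
      case (elim m)
      show ?case
      proof
        fix r assume r: "r \<in> {0..T}"
        have "dist (L2_inner (w r) (gm m)) (L2_inner (w r) g) = \<bar>L2_inner (w r) (\<lambda>y. gm m y - g y)\<bar>"
          by (simp add: dist_real_def L2_inner_diff_right g w(1)[OF r])
        also have "\<dots> \<le> L2_norm (w r) * L2_norm (\<lambda>y. gm m y - g y)"
          by (intro L2_Cauchy_Schwarz L2_diff g w(1)[OF r])
        also have "\<dots> \<le> \<bar>B\<bar> * L2_norm (\<lambda>y. gm m y - g y)"
          using w(2)[OF r] by (intro mult_right_mono L2_norm_nonneg) auto
        finally show "dist (L2_inner (w r) (gm m)) (L2_inner (w r) g) < e" using elim by simp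
      qed
    qed
  qed
  from uniform_limit_integral[OF this c trivial_limit_sequentially]
  obtain I J where I: "\<And>m. ((\<lambda>r. L2_inner (w r) (gm m)) has_integral I m) {0..T}"
    and J: "((\<lambda>r. L2_inner (w r) g) has_integral J) {0..T}" and lim: "I \<longlonglongrightarrow> J"
    by blast
  show ?thesis using lim unfolding integral_unique[OF I] integral_unique[OF J] .
qed

section \<open>From the distributional system to the Fourier modes\<close>

lemma test_fun2_product:
  assumes \<beta>: "test_fun \<beta>"
  shows "test_fun2 (\<lambda>t y. cutoff 0 T m t * \<beta> y)"
proof -
  let ?\<alpha> = "cutoff 0 T m"
  let ?D = "\<lambda>i j t y. (deriv ^^ i) ?\<alpha> t * (deriv ^^ j) \<beta> y"
  have s: "smooth ((deriv ^^ i) ?\<alpha>)" "smooth ((deriv ^^ j) \<beta>)" for i j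
    by (intro smooth_deriv_iter smooth_cutoff test_fun_smooth \<beta>)+
  obtain K where K: "compact K" "K \<subseteq> {0<..<1}" "\<And>x. x \<notin> K \<Longrightarrow> \<beta> x = 0"
    using \<beta> unfolding test_fun_def by blast
  let ?J = "{0 + inverse (real (Suc m)) .. T - inverse (real (Suc m))}"
  \<comment> \<open>The cutoff of \<open>[0,T]\<close> also stays away from \<open>t = 0\<close>, as a test function on \<open>t > 0\<close> must.\<close>
  have J: "?J \<subseteq> {0<..}"
  proof
    fix t assume "t \<in> ?J"
    then have "inverse (real (Suc m)) \<le> t" by simp
    moreover have "0 < inverse (real (Suc m))" by simp
    ultimately show "t \<in> {0<..}" unfolding greaterThan_iff by linarith
  qed
  have c: "continuous_on UNIV (\<lambda>(t, y). ?D i j t y)" for i j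
    unfolding case_prod_beta
    by (intro continuous_on_mult
        continuous_on_compose2[OF smooth_continuous[OF s(1)] continuous_on_fst[OF continuous_on_id] subset_UNIV]
        continuous_on_compose2[OF smooth_continuous[OF s(2)] continuous_on_snd[OF continuous_on_id] subset_UNIV])
  have d1: "((\<lambda>s. ?D i j s y) has_real_derivative ?D (Suc i) j t y) (at t)" for i j t y
    using DERIV_cmult_right[OF smooth_has_deriv[OF s(1)]] by simp
  have d2: "(?D i j t has_real_derivative ?D i (Suc j) t y) (at y)" for i j t y
    using DERIV_cmult[OF smooth_has_deriv[OF s(2)]] by simp
  have D0: "?D 0 0 = (\<lambda>t y. ?\<alpha> t * \<beta> y)" by simp
  have "?\<alpha> t * \<beta> y = 0" if "(t, y) \<notin> ?J \<times> K" for t y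
    using that K(3)[of y] cutoff_eq_0[of t 0 m T] by auto
  then have supp: "\<forall>t y. (t, y) \<notin> ?J \<times> K \<longrightarrow> ?\<alpha> t * \<beta> y = 0" by blast
  have JK: "compact (?J \<times> K)" "?J \<times> K \<subseteq> {0<..} \<times> {0<..<1}"
    by (intro compact_Times compact_Icc K(1)) (intro Sigma_mono J K(2))
  show ?thesis
    unfolding test_fun2_def
    by (intro conjI exI[of _ ?D] exI[of _ "?J \<times> K"] allI D0 c d1 d2 JK supp)
qed

text \<open>
The distribution of \<open>w\<close> separates on products of a function of time and a function of space.
\<close>

lemma distr_product:
  assumes w: "w \<in> C_time H1 H1_norm" and \<beta>: "\<beta> \<in> L2"
    and \<theta>: "continuous_on {0..T} \<theta>" "\<And>t. t \<notin> {0..T} \<Longrightarrow> \<theta> t = 0"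
  shows "distr w (\<lambda>t y. \<theta> t * \<beta> y) = integral {0..T} (\<lambda>t. \<theta> t * L2_inner (w t) \<beta>)"
proof -
  let ?F = "\<lambda>t. \<theta> t * L2_inner (w t) \<beta>"
  have c: "continuous_on {0..T} ?F"
    by (intro continuous_on_mult \<theta> continuous_on_subset[OF C_time_inner_continuous[OF w \<beta>]]) auto
  have "distr w (\<lambda>t y. \<theta> t * \<beta> y) = (LINT t|lebesgue_on {0..}. ?F t)"
    unfolding distr_def L2_inner_def by (simp add: mult.left_commute[of _ "\<theta> _"])
  also have "\<dots> = (LINT t|lebesgue. indicator {0..} t *\<^sub>R ?F t)"
    by (rule integral_restrict_space) simp
  also have "\<dots> = (LINT t|lebesgue. indicator {0..T} t *\<^sub>R ?F t)"
    using \<theta>(2) by (intro Bochner_Integration.integral_cong) (auto simp: indicator_def)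
  also have "\<dots> = (LINT t|lebesgue_on {0..T}. ?F t)"
    by (rule integral_restrict_space[symmetric]) simp
  also have "\<dots> = integral {0..T} ?F"
    using c by (intro lebesgue_integral_eq_integral continuous_imp_integrable_real) auto
  finally show ?thesis .
qed

lemma cutoff_outside: "t \<notin> {0..T} \<Longrightarrow> cutoff 0 T m t = 0"
  and dcutoff_outside: "t \<notin> {0..T} \<Longrightarrow> dcutoff 0 T m t = 0"
proof -
  assume t: "t \<notin> {0..T}"
  have "0 < inverse (real (Suc m))" by simp
  with t have "t \<notin> {0 + inverse (real (Suc m)) .. T - inverse (real (Suc m))}"
    unfolding atLeastAtMost_iff by linarith
  then show "cutoff 0 T m t = 0" "dcutoff 0 T m t = 0"
    using cutoff_eq_0 dcutoff_eq_0 by blast+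
qed

lemma dist_dt_product:
  assumes w: "w \<in> C_time H1 H1_norm" and \<beta>: "\<beta> \<in> L2"
  shows "dist_dt (distr w) (\<lambda>t y. cutoff 0 T m t * \<beta> y) = - integral {0..T} (\<lambda>t. dcutoff 0 T m t * L2_inner (w t) \<beta>)"
proof -
  have "deriv (\<lambda>s. cutoff 0 T m s * \<beta> y) t = dcutoff 0 T m t * \<beta> y" for t y
    by (intro DERIV_imp_deriv DERIV_cmult_right cutoff_deriv)
  moreover have "distr w (\<lambda>t y. dcutoff 0 T m t * \<beta> y) = integral {0..T} (\<lambda>t. dcutoff 0 T m t * L2_inner (w t) \<beta>)"
    by (rule distr_product[OF w \<beta> continuous_dcutoff dcutoff_outside])
  ultimately show ?thesis by (simp only: dist_dt_def)
qed

lemma deriv_product: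
  assumes "test_fun \<beta>"
  shows "deriv (\<lambda>y. c * \<beta> y) = (\<lambda>y. c * deriv \<beta> y)"
  using smooth_has_deriv[OF test_fun_smooth[OF assms]] by (intro ext DERIV_imp_deriv DERIV_cmult)

lemma dist_dy_product:
  assumes w: "w \<in> C_time H1 H1_norm" and \<beta>: "test_fun \<beta>"
  shows "dist_dy (distr w) (\<lambda>t y. cutoff 0 T m t * \<beta> y)
      = - integral {0..T} (\<lambda>t. cutoff 0 T m t * L2_inner (w t) (deriv \<beta>))"
  unfolding dist_dy_def deriv_product[OF \<beta>]
  by (subst distr_product[OF w test_fun_L2[OF test_fun_deriv[OF \<beta>]] continuous_cutoff cutoff_outside]) auto

lemma dist_dyy_product:
  assumes w: "w \<in> C_time H1 H1_norm" and \<beta>: "test_fun \<beta>"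
  shows "dist_dy (dist_dy (distr w)) (\<lambda>t y. cutoff 0 T m t * \<beta> y)
      = integral {0..T} (\<lambda>t. cutoff 0 T m t * L2_inner (w t) (deriv (deriv \<beta>)))"
  unfolding dist_dy_def[of "dist_dy (distr w)"] deriv_product[OF \<beta>]
  by (simp add: dist_dy_product[OF w test_fun_deriv[OF \<beta>]])

locale viscoelastic_solution =
  fixes \<rho> \<eta> lam G :: real and u \<tau> :: "real \<Rightarrow> real \<Rightarrow> real"
  assumes u: "u \<in> C_time H1 H1_norm" and \<tau>: "\<tau> \<in> C_time H1 H1_norm"
    and system: "solves_system \<rho> \<eta> lam G u \<tau>"
    and boundary: "\<And>t. t \<ge> 0 \<Longrightarrow> zero_boundary (u t)"
begin

lemma time_continuous:
  assumes "g \<in> L2"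
  shows "continuous_on {0..T} (\<lambda>t. L2_inner (u t) g)" "continuous_on {0..T} (\<lambda>t. L2_inner (\<tau> t) g)"
  using assms by (auto intro: continuous_on_subset[OF C_time_inner_continuous[OF u]]
      continuous_on_subset[OF C_time_inner_continuous[OF \<tau>]])

text \<open>
The first equation of the system, integrated over \<open>[0,T]\<close> and tested in space only: the test functions
are cutoffs of \<open>[0,T]\<close> times \<open>\<beta>\<close>, and the cutoffs tend to the indicator function.
\<close>

lemma momentum_weak:
  assumes \<beta>: "test_fun \<beta>" and T: "T \<ge> 0"
  shows "\<rho> * (L2_inner (u T) \<beta> - L2_inner (u 0) \<beta>)
    = integral {0..T} (\<lambda>t. \<eta> * L2_inner (u t) (deriv (deriv \<beta>)) - L2_inner (\<tau> t) (deriv \<beta>))"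
proof (cases "T = 0")
  case False
  then have T: "0 < T" using T by simp
  have L: "\<beta> \<in> L2" "deriv \<beta> \<in> L2" "deriv (deriv \<beta>) \<in> L2"
    using \<beta> by (auto intro: test_fun_L2 test_fun_deriv)
  let ?a = "\<lambda>t. L2_inner (u t) \<beta>" and ?c = "\<lambda>t. L2_inner (u t) (deriv (deriv \<beta>))"
    and ?d = "\<lambda>t. L2_inner (\<tau> t) (deriv \<beta>)"
  have eq: "- (\<rho> * integral {0..T} (\<lambda>t. dcutoff 0 T m t * ?a t))
      = \<eta> * integral {0..T} (\<lambda>t. cutoff 0 T m t * ?c t) - integral {0..T} (\<lambda>t. cutoff 0 T m t * ?d t)" for m
  proof -
    let ?\<phi> = "\<lambda>t y. cutoff 0 T m t * \<beta> y"
    have "\<rho> * dist_dt (distr u) ?\<phi> = \<eta> * dist_dy (dist_dy (distr u)) ?\<phi> + dist_dy (distr \<tau>) ?\<phi>"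
      using system test_fun2_product[OF \<beta>] unfolding solves_system_def by blast
    then show ?thesis
      unfolding dist_dt_product[OF u L(1)] dist_dyy_product[OF u \<beta>] dist_dy_product[OF \<tau> \<beta>] by simp
  qed
  have "(\<lambda>m. - (\<rho> * integral {0..T} (\<lambda>t. dcutoff 0 T m t * ?a t))) \<longlonglongrightarrow> - (\<rho> * (?a 0 - ?a T))"
    by (intro tendsto_intros dcutoff_integral_tendsto T time_continuous L)
  moreover have "(\<lambda>m. \<eta> * integral {0..T} (\<lambda>t. cutoff 0 T m t * ?c t) - integral {0..T} (\<lambda>t. cutoff 0 T m t * ?d t))
      \<longlonglongrightarrow> \<eta> * integral {0..T} ?c - integral {0..T} ?d"
    by (intro tendsto_intros cutoff_integral_tendsto time_continuous L)
  ultimately have "- (\<rho> * (?a 0 - ?a T)) = \<eta> * integral {0..T} ?c - integral {0..T} ?d"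
    unfolding eq by (rule LIMSEQ_unique)
  also have "\<dots> = integral {0..T} (\<lambda>t. \<eta> * ?c t - ?d t)"
  proof -
    have "(\<lambda>t. \<eta> * ?c t) integrable_on {0..T}" "?d integrable_on {0..T}"
      by (intro integrable_continuous_interval continuous_intros time_continuous L)+
    then show ?thesis by (simp add: integral_diff)
  qed
  finally show ?thesis by (simp add: right_diff_distrib)
qed simp

lemma stress_weak:
  assumes \<beta>: "test_fun \<beta>" and T: "T \<ge> 0"
  shows "lam * (L2_inner (\<tau> T) \<beta> - L2_inner (\<tau> 0) \<beta>) = - (G * integral {0..T} (\<lambda>t. L2_inner (u t) (deriv \<beta>)))"
proof (cases "T = 0")
  case False
  then have T: "0 < T" using T by simp
  have L: "\<beta> \<in> L2" "deriv \<beta> \<in> L2"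
    using \<beta> by (auto intro: test_fun_L2 test_fun_deriv)
  let ?a = "\<lambda>t. L2_inner (\<tau> t) \<beta>" and ?c = "\<lambda>t. L2_inner (u t) (deriv \<beta>)"
  have eq: "- (lam * integral {0..T} (\<lambda>t. dcutoff 0 T m t * ?a t))
      = - (G * integral {0..T} (\<lambda>t. cutoff 0 T m t * ?c t))" for m
  proof -
    let ?\<phi> = "\<lambda>t y. cutoff 0 T m t * \<beta> y"
    have "lam * dist_dt (distr \<tau>) ?\<phi> = G * dist_dy (distr u) ?\<phi>"
      using system test_fun2_product[OF \<beta>] unfolding solves_system_def by blast
    then show ?thesis
      unfolding dist_dt_product[OF \<tau> L(1)] dist_dy_product[OF u \<beta>] by simp
  qed
  have "(\<lambda>m. - (lam * integral {0..T} (\<lambda>t. dcutoff 0 T m t * ?a t))) \<longlonglongrightarrow> - (lam * (?a 0 - ?a T))"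
    by (intro tendsto_intros dcutoff_integral_tendsto T time_continuous L)
  moreover have "(\<lambda>m. - (G * integral {0..T} (\<lambda>t. cutoff 0 T m t * ?c t))) \<longlonglongrightarrow> - (G * integral {0..T} ?c)"
    by (intro tendsto_intros cutoff_integral_tendsto time_continuous L)
  ultimately have "- (lam * (?a 0 - ?a T)) = - (G * integral {0..T} ?c)"
    unfolding eq by (rule LIMSEQ_unique)
  then show ?thesis by (simp add: right_diff_distrib)
qed simp

definition strain_mode :: "nat \<Rightarrow> real \<Rightarrow> real" where
  "strain_mode n t = L2_inner (Dy (u t)) (cosn n)"

definition stress_mode :: "nat \<Rightarrow> real \<Rightarrow> real" where
  "stress_mode n t = L2_inner (\<tau> t) (cosn n)"

text \<open>
The right-hand side is continuous in \<open>t\<close>, and it is the form in which the momentum equation, tested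
with a sine, determines the mode.
\<close>

lemma strain_mode_eq: "t \<ge> 0 \<Longrightarrow> strain_mode n t = real n * pi * L2_inner (u t) (sinn n)"
  unfolding strain_mode_def by (intro inner_Dy_cosn C_time_H1[OF u] boundary)

lemma continuous_strain_mode: "continuous_on {0..T} (strain_mode n)"
proof -
  have "continuous_on {0..T} (\<lambda>t. real n * pi * L2_inner (u t) (sinn n))"
    by (intro continuous_intros time_continuous sinn_L2)
  then show ?thesis by (rule continuous_on_eq) (simp add: strain_mode_eq)
qed

lemma continuous_stress_mode: "continuous_on {0..T} (stress_mode n)"
  unfolding stress_mode_def [abs_def] by (intro time_continuous cosn_L2)

text \<open>
The second equation tested with a cosine. The derivative is moved to \<open>u\<close> while the test function still
has compact support; the limit then only involves the cosine itself.
\<close>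

lemma stress_mode_evolution:
  assumes T: "T \<ge> 0"
  shows "lam * (stress_mode n T - stress_mode n 0) = G * integral {0..T} (strain_mode n)"
proof -
  obtain B where B: "\<And>r. r \<in> {0..T} \<Longrightarrow> L2_norm (Dy (u r)) \<le> B"
    using C_time_bounded[OF u] by meson
  have uH: "u r \<in> H1" if "r \<in> {0..T}" for r using that C_time_H1[OF u] by simp
  have \<tau>L: "\<tau> r \<in> L2" if "r \<in> {0..T}" for r using that C_time_H1[OF \<tau>] H1_L2 by simp
  have cL: "cut_cos n m \<in> L2" for m by (intro test_fun_L2 cut_cos_test_fun)
  have wd: "L2_inner (u r) (deriv (cut_cos n m)) = - L2_inner (Dy (u r)) (cut_cos n m)" if "r \<in> {0..T}" for r m
    using weak_deriv_inner[OF Dy_weak_deriv[OF uH[OF that]] cut_cos_test_fun] .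
  have eq: "lam * (L2_inner (\<tau> T) (cut_cos n m) - L2_inner (\<tau> 0) (cut_cos n m))
      = G * integral {0..T} (\<lambda>t. L2_inner (Dy (u t)) (cut_cos n m))" for m
  proof -
    have "integral {0..T} (\<lambda>t. L2_inner (u t) (deriv (cut_cos n m)))
        = integral {0..T} (\<lambda>t. - L2_inner (Dy (u t)) (cut_cos n m))"
      by (intro Henstock_Kurzweil_Integration.integral_cong wd)
    then show ?thesis using stress_weak[OF cut_cos_test_fun T, of n m] by simp
  qed
  have "(\<lambda>m. lam * (L2_inner (\<tau> T) (cut_cos n m) - L2_inner (\<tau> 0) (cut_cos n m)))
      \<longlonglongrightarrow> lam * (stress_mode n T - stress_mode n 0)"
    unfolding stress_mode_def
    by (intro tendsto_mult_left tendsto_diff L2_inner_tendsto[OF \<tau>L cosn_L2 cL cut_cos_L2_tendsto]) (use T in auto)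
  moreover have "(\<lambda>m. G * integral {0..T} (\<lambda>t. L2_inner (Dy (u t)) (cut_cos n m)))
      \<longlonglongrightarrow> G * integral {0..T} (strain_mode n)"
    unfolding strain_mode_def [abs_def]
  proof (rule tendsto_mult_left, rule integral_inner_tendsto[where B = B])
    show "Dy (u r) \<in> L2" if "r \<in> {0..T}" for r by (rule Dy_L2[OF uH[OF that]])
    show "L2_norm (Dy (u r)) \<le> B" if "r \<in> {0..T}" for r by (rule B[OF that])
    show "continuous_on {0..T} (\<lambda>r. L2_inner (Dy (u r)) (cut_cos n m))" for m
    proof (rule continuous_on_eq)
      show "continuous_on {0..T} (\<lambda>r. - L2_inner (u r) (deriv (cut_cos n m)))"
        by (intro continuous_intros time_continuous test_fun_L2 test_fun_deriv cut_cos_test_fun)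
    qed (simp add: wd)
  qed (rule cosn_L2 cL cut_cos_L2_tendsto)+
  ultimately show ?thesis unfolding eq by (rule LIMSEQ_unique)
qed

text \<open>
The first equation tested with a sine. One of the two derivatives is moved to \<open>u\<close>, and the first
derivatives of the test functions converge by \<open>deriv_cut_sin_L2_tendsto\<close>. The factor \<open>k\<^sup>2\<close> has one \<open>k\<close>
from the derivative of the sine and one from \<open>strain_mode_eq\<close>.
\<close>

lemma strain_mode_evolution:
  assumes T: "T \<ge> 0"
  shows "\<rho> * (strain_mode n T - strain_mode n 0)
    = - ((real n * pi)\<^sup>2 * integral {0..T} (\<lambda>t. \<eta> * strain_mode n t + stress_mode n t))"
proof -
  let ?k = "real n * pi"
  let ?w = "\<lambda>r y. \<eta> * Dy (u r) y + \<tau> r y"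
  obtain B1 where B1: "\<And>r. r \<in> {0..T} \<Longrightarrow> L2_norm (Dy (u r)) \<le> B1"
    using C_time_bounded[OF u] by meson
  obtain B2 where B2: "\<And>r. r \<in> {0..T} \<Longrightarrow> L2_norm (\<tau> r) \<le> B2"
    using C_time_bounded[OF \<tau>] by meson
  have uH: "u r \<in> H1" if "r \<in> {0..T}" for r using that C_time_H1[OF u] by simp
  have uL: "u r \<in> L2" if "r \<in> {0..T}" for r using H1_L2[OF uH[OF that]] .
  have \<tau>H: "\<tau> r \<in> H1" if "r \<in> {0..T}" for r using that C_time_H1[OF \<tau>] by simp
  have sL: "cut_sin n m \<in> L2" for m by (intro test_fun_L2 cut_sin_test_fun)
  have dL: "deriv (cut_sin n m) \<in> L2" for m by (intro test_fun_L2 test_fun_deriv cut_sin_test_fun)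
  have ddL: "deriv (deriv (cut_sin n m)) \<in> L2" for m by (intro test_fun_L2 test_fun_deriv cut_sin_test_fun)
  have wL: "?w r \<in> L2" if "r \<in> {0..T}" for r
    using uH[OF that] \<tau>H[OF that] by (intro L2_add L2_scale Dy_L2 H1_L2)
  have wB: "L2_norm (?w r) \<le> \<bar>\<eta>\<bar> * B1 + B2" if "r \<in> {0..T}" for r
  proof -
    have "L2_norm (?w r) \<le> L2_norm (\<lambda>y. \<eta> * Dy (u r) y) + L2_norm (\<tau> r)"
      using uH[OF that] \<tau>H[OF that] by (intro L2_norm_triangle L2_scale Dy_L2 H1_L2)
    also have "\<dots> \<le> \<bar>\<eta>\<bar> * B1 + B2"
      unfolding L2_norm_scale using B1[OF that] B2[OF that] by (intro add_mono mult_left_mono) auto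
    finally show ?thesis .
  qed
  have w_inner: "L2_inner (?w r) g = \<eta> * L2_inner (Dy (u r)) g + L2_inner (\<tau> r) g" if "r \<in> {0..T}" "g \<in> L2" for r g
    using uH[OF that(1)] \<tau>H[OF that(1)] that(2)
    by (simp add: L2_inner_add_left L2_scale Dy_L2 H1_L2 L2_inner_scale_left)
  have wd: "\<eta> * L2_inner (u r) (deriv (deriv (cut_sin n m))) - L2_inner (\<tau> r) (deriv (cut_sin n m))
      = - L2_inner (?w r) (deriv (cut_sin n m))" if "r \<in> {0..T}" for r m
    using weak_deriv_inner[OF Dy_weak_deriv[OF uH[OF that]] test_fun_deriv[OF cut_sin_test_fun]]
    by (simp add: w_inner[OF that dL])
  have eq: "\<rho> * (L2_inner (u T) (cut_sin n m) - L2_inner (u 0) (cut_sin n m))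
      = - integral {0..T} (\<lambda>r. L2_inner (?w r) (deriv (cut_sin n m)))" for m
  proof -
    have "integral {0..T} (\<lambda>r. \<eta> * L2_inner (u r) (deriv (deriv (cut_sin n m))) - L2_inner (\<tau> r) (deriv (cut_sin n m)))
        = integral {0..T} (\<lambda>r. - L2_inner (?w r) (deriv (cut_sin n m)))"
      by (intro Henstock_Kurzweil_Integration.integral_cong wd)
    then show ?thesis using momentum_weak[OF cut_sin_test_fun T, of n m] by simp
  qed
  have "(\<lambda>m. \<rho> * (L2_inner (u T) (cut_sin n m) - L2_inner (u 0) (cut_sin n m)))
      \<longlonglongrightarrow> \<rho> * (L2_inner (u T) (sinn n) - L2_inner (u 0) (sinn n))"
    by (intro tendsto_mult_left tendsto_diff L2_inner_tendsto[OF uL sinn_L2 sL cut_sin_L2_tendsto]) (use T in auto)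
  moreover have "(\<lambda>m. - integral {0..T} (\<lambda>r. L2_inner (?w r) (deriv (cut_sin n m))))
      \<longlonglongrightarrow> - integral {0..T} (\<lambda>r. L2_inner (?w r) (\<lambda>y. ?k * cosn n y))"
  proof (rule tendsto_minus, rule integral_inner_tendsto[where B = "\<bar>\<eta>\<bar> * B1 + B2"])
    show "?w r \<in> L2" if "r \<in> {0..T}" for r by (rule wL[OF that])
    show "L2_norm (?w r) \<le> \<bar>\<eta>\<bar> * B1 + B2" if "r \<in> {0..T}" for r by (rule wB[OF that])
    show "continuous_on {0..T} (\<lambda>r. L2_inner (?w r) (deriv (cut_sin n m)))" for m
    proof (rule continuous_on_eq)
      show "continuous_on {0..T} (\<lambda>r. - (\<eta> * L2_inner (u r) (deriv (deriv (cut_sin n m))) - L2_inner (\<tau> r) (deriv (cut_sin n m))))"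
        by (intro continuous_intros time_continuous dL ddL)
    qed (simp add: wd)
  qed (rule dL L2_scale cosn_L2 deriv_cut_sin_L2_tendsto)+
  ultimately have "\<rho> * (L2_inner (u T) (sinn n) - L2_inner (u 0) (sinn n))
      = - integral {0..T} (\<lambda>r. L2_inner (?w r) (\<lambda>y. ?k * cosn n y))"
    unfolding eq by (rule LIMSEQ_unique)
  also have "integral {0..T} (\<lambda>r. L2_inner (?w r) (\<lambda>y. ?k * cosn n y))
      = integral {0..T} (\<lambda>r. ?k * (\<eta> * strain_mode n r + stress_mode n r))"
    by (intro Henstock_Kurzweil_Integration.integral_cong)
       (simp add: L2_inner_scale_right w_inner cosn_L2 strain_mode_def stress_mode_def)
  finally have "\<rho> * (L2_inner (u T) (sinn n) - L2_inner (u 0) (sinn n))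
      = - (?k * integral {0..T} (\<lambda>r. \<eta> * strain_mode n r + stress_mode n r))" by simp
  then have "?k * (\<rho> * (L2_inner (u T) (sinn n) - L2_inner (u 0) (sinn n)))
      = ?k * - (?k * integral {0..T} (\<lambda>r. \<eta> * strain_mode n r + stress_mode n r))" by simp
  then show ?thesis using T by (simp add: strain_mode_eq algebra_simps power2_eq_square)
qed

end

section \<open>Uniform decay of the modes\<close>

lemma integral_eq_imp_deriv:
  fixes f g :: "real \<Rightarrow> real"
  assumes c: "c \<noteq> 0" and eq: "\<And>T. T \<ge> 0 \<Longrightarrow> c * (f T - f 0) = integral {0..T} g"
    and g: "\<And>T. continuous_on {0..T} g" and t: "t > 0"
  shows "(f has_real_derivative g t / c) (at t)"
proof -
  have "((\<lambda>T. integral {0..T} g) has_real_derivative g t) (at t within {0..t + 1})"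
    using t by (intro integral_has_real_derivative g) auto
  then have "((\<lambda>T. integral {0..T} g) has_real_derivative g t) (at t)"
    using t by (simp add: at_within_interior[of t "{0..t + 1}"])
  then have "((\<lambda>T. f 0 + integral {0..T} g / c) has_real_derivative g t / c) (at t)"
    using c by (auto intro!: derivative_eq_intros)
  moreover have "\<forall>\<^sub>F T in nhds t. f 0 + integral {0..T} g / c = f T"
  proof -
    have "\<forall>\<^sub>F T in nhds t. T > 0" using t by (intro order_tendstoD(1)) (auto intro: filterlim_ident)
    then show ?thesis
    proof eventually_elim
      case (elim T)
      then show ?case using c eq[of T, symmetric] by simp
    qed
  qed
  ultimately show ?thesis by (subst (asm) DERIV_cong_ev[OF refl _ refl])
qed

lemma exponential_decay_of_dissipation:
  fixes V V' :: "real \<Rightarrow> real"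
  assumes c: "\<And>T. continuous_on {0..T} V"
    and d: "\<And>t. t > 0 \<Longrightarrow> (V has_real_derivative V' t) (at t)"
    and le: "\<And>t. t > 0 \<Longrightarrow> V' t \<le> - c * V t" and t: "t \<ge> 0"
  shows "V t \<le> exp (- c * t) * V 0"
proof -
  have "V t * exp (c * t) \<le> V 0 * exp (c * 0)"
  proof (rule DERIV_nonpos_imp_decreasing_open[OF t])
    show "continuous_on {0..t} (\<lambda>t. V t * exp (c * t))" by (intro continuous_intros assms(1))
    fix x assume x: "0 < x" "x < t"
    have "((\<lambda>t. V t * exp (c * t)) has_real_derivative (V' x + c * V x) * exp (c * x)) (at x)"
      using d[OF x(1)] by (auto intro!: derivative_eq_intros simp: algebra_simps)
    moreover have "(V' x + c * V x) * exp (c * x) \<le> 0"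
      using le[OF x(1)] by (intro mult_nonpos_nonneg) auto
    ultimately show "\<exists>y. ((\<lambda>t. V t * exp (c * t)) has_real_derivative y) (at x) \<and> y \<le> 0" by blast
  qed
  then show ?thesis by (simp add: exp_minus field_simps)
qed

text \<open>
The equations \<open>\<rho> p' = - k\<^sup>2 (\<eta> p + b)\<close> and \<open>\<lambda> b' = G p\<close>, integrated in time, which is the form that the
distributional system yields.
\<close>

definition mode_system ::
  "real \<Rightarrow> real \<Rightarrow> real \<Rightarrow> real \<Rightarrow> real \<Rightarrow> (real \<Rightarrow> real) \<Rightarrow> (real \<Rightarrow> real) \<Rightarrow> bool" where
  "mode_system \<rho> \<eta> lam G k p b \<longleftrightarrow>
     (\<forall>T. continuous_on {0..T} p \<and> continuous_on {0..T} b) \<and>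
     (\<forall>T\<ge>0. \<rho> * (p T - p 0) = - (k\<^sup>2 * integral {0..T} (\<lambda>t. \<eta> * p t + b t)) \<and>
            lam * (b T - b 0) = G * integral {0..T} p)"

text \<open>
The Lyapunov function is \<open>V = A (\<rho> p\<^sup>2 / k\<^sup>2 + \<lambda> b\<^sup>2 / G) + q\<^sup>2\<close> with \<open>q = \<eta> p + b\<close>. In the derivative of
the first part the terms with \<open>p b\<close> cancel, so that
\<open>V'/2 = - A \<eta> p\<^sup>2 - (\<eta> k\<^sup>2 / \<rho>) q\<^sup>2 + (G/\<lambda>) p q\<close>. Absorbing the mixed term and bounding
\<open>V\<close> by \<open>p\<^sup>2 + q\<^sup>2\<close> use \<open>k\<close> only through \<open>k \<ge> \<pi>\<close>; hence all constants are uniform in \<open>k\<close>.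
\<close>

lemma mode_decay:
  fixes \<rho> \<eta> lam G :: real
  assumes pos: "\<rho> > 0" "\<eta> > 0" "lam > 0" "G > 0"
  shows "\<exists>C>0. \<exists>M\<ge>0. \<forall>k\<ge>pi. \<forall>p b. mode_system \<rho> \<eta> lam G k p b \<longrightarrow>
    (\<forall>t\<ge>0. (p t)\<^sup>2 + (b t)\<^sup>2 \<le> M * exp (- (2 * C) * t) * ((p 0)\<^sup>2 + (b 0)\<^sup>2))"
proof -
  define \<kappa> where "\<kappa> = \<eta> * pi\<^sup>2 / \<rho>"
  define g where "g = G / lam"
  \<comment> \<open>Of \<open>A \<eta> p\<^sup>2\<close> the second summand of \<open>A\<close> pays for the mixed term; \<open>\<eta> p\<^sup>2\<close> is left.\<close>
  define A where "A = 1 + g\<^sup>2 / (2 * \<kappa> * \<eta>)"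
  \<comment> \<open>\<open>V \<le> C1 (p\<^sup>2 + q\<^sup>2)\<close>, after \<open>b\<close> is replaced by \<open>q - \<eta> p\<close>.\<close>
  define C1 where "C1 = (A * \<rho> / pi\<^sup>2 + 2 * A * \<eta>\<^sup>2 / g) + (2 * A / g + 1)"
  define C where "C = min \<eta> (\<kappa> / 2) / C1"
  \<comment> \<open>The first two factors bound \<open>p\<^sup>2 + b\<^sup>2\<close> by \<open>V\<close>, the last one bounds \<open>V\<close> by \<open>p\<^sup>2 + b\<^sup>2\<close>.\<close>
  define M where "M = (2 / \<eta>\<^sup>2 + 1) * (1 + g / A) * (C1 * (3 + 2 * \<eta>\<^sup>2))"
  have \<kappa>: "\<kappa> > 0" and g: "g > 0" using pos by (auto simp: \<kappa>_def g_def)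
  have A: "A > 0" using \<kappa> g pos by (auto simp: A_def intro!: add_pos_nonneg)
  have C1: "C1 > 0" using A g pos by (auto simp: C1_def intro!: add_nonneg_pos add_nonneg_nonneg)
  have C: "C > 0" using C1 \<kappa> pos by (simp add: C_def)
  have M: "M \<ge> 0" using C1 A g by (simp add: M_def)
  show ?thesis
  proof (rule exI[of _ C], intro conjI C, rule exI[of _ M], intro conjI M allI impI)
    fix k t :: real and p b :: "real \<Rightarrow> real"
    assume k: "k \<ge> pi" and sys: "mode_system \<rho> \<eta> lam G k p b" and t: "t \<ge> 0"
    have pc: "continuous_on {0..T} p" and bc: "continuous_on {0..T} b" for T
      using sys by (auto simp: mode_system_def)
    have pe: "\<rho> * (p T - p 0) = - (k\<^sup>2 * integral {0..T} (\<lambda>t. \<eta> * p t + b t))"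
      and be: "lam * (b T - b 0) = G * integral {0..T} p" if "T \<ge> 0" for T
      using sys that by (auto simp: mode_system_def)
    have k0: "k > 0" using k pi_gt_zero by linarith
    have k2: "pi\<^sup>2 \<le> k\<^sup>2" using k by (intro power_mono) auto
    define q where "q = (\<lambda>t. \<eta> * p t + b t)"
    define V where "V = (\<lambda>t. A * (\<rho> / k\<^sup>2 * (p t)\<^sup>2 + (b t)\<^sup>2 / g) + (q t)\<^sup>2)"
    define V' where "V' = (\<lambda>t. - 2 * A * \<eta> * (p t)\<^sup>2 - 2 * (\<eta> * k\<^sup>2 / \<rho>) * (q t)\<^sup>2 + 2 * (g * p t * q t))"
    have qc: "continuous_on {0..T} q" for T unfolding q_def by (intro continuous_intros pc bc)
    have pd: "(p has_real_derivative - (k\<^sup>2 / \<rho>) * q t) (at t)" if "t > 0" for t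
    proof -
      have "(p has_real_derivative q t / (- \<rho> / k\<^sup>2)) (at t)"
      proof (rule integral_eq_imp_deriv[OF _ _ qc that])
        show "- \<rho> / k\<^sup>2 * (p T - p 0) = integral {0..T} q" if "T \<ge> 0" for T
          using pe[OF that] k0 by (simp add: q_def field_simps)
      qed (use pos k0 in auto)
      then show ?thesis by (simp add: field_simps)
    qed
    have bd: "(b has_real_derivative g * p t) (at t)" if "t > 0" for t
    proof -
      have "(b has_real_derivative p t / (lam / G)) (at t)"
      proof (rule integral_eq_imp_deriv[OF _ _ pc that])
        show "lam / G * (b T - b 0) = integral {0..T} p" if "T \<ge> 0" for T
          using be[OF that] pos by (simp add: field_simps)
      qed (use pos in auto)
      then show ?thesis by (simp add: g_def field_simps)
    qed
    have qd: "(q has_real_derivative \<eta> * (- (k\<^sup>2 / \<rho>) * q t) + g * p t) (at t)" if "t > 0" for t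
      unfolding q_def using DERIV_add[OF DERIV_cmult[OF pd[OF that], of \<eta>] bd[OF that]] by (simp add: q_def)
    have sq: "((\<lambda>t. (f t)\<^sup>2) has_real_derivative 2 * f t * f') (at t)"
      if "(f has_real_derivative f') (at t)" for f :: "real \<Rightarrow> real" and f' t
      using that by (auto intro!: derivative_eq_intros)
    have Vd: "(V has_real_derivative V' t) (at t)" if "t > 0" for t
    proof -
      have "(V has_real_derivative
          A * (\<rho> / k\<^sup>2 * (2 * p t * (- (k\<^sup>2 / \<rho>) * q t)) + 2 * b t * (g * p t) / g)
          + 2 * q t * (\<eta> * (- (k\<^sup>2 / \<rho>) * q t) + g * p t)) (at t)"
        unfolding V_def
        by (intro DERIV_add[OF DERIV_cmult[OF DERIV_add[OF DERIV_cmult[OF sq[OF pd]] DERIV_cdivide[OF sq[OF bd]]]]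
              sq[OF qd]] that)
      also have "A * (\<rho> / k\<^sup>2 * (2 * p t * (- (k\<^sup>2 / \<rho>) * q t)) + 2 * b t * (g * p t) / g)
          = - 2 * A * \<eta> * (p t)\<^sup>2"
        using g k0 pos by (simp add: q_def field_simps power2_eq_square)
      also have "- 2 * A * \<eta> * (p t)\<^sup>2 + 2 * q t * (\<eta> * (- (k\<^sup>2 / \<rho>) * q t) + g * p t) = V' t"
        by (simp add: V'_def algebra_simps power2_eq_square)
      finally show ?thesis .
    qed
    have V_le: "V s \<le> C1 * ((p s)\<^sup>2 + (q s)\<^sup>2)" for s
    proof -
      have "b s = q s - \<eta> * p s" by (simp add: q_def)
      moreover have "(x - y)\<^sup>2 \<le> 2 * x\<^sup>2 + 2 * y\<^sup>2" for x y :: real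
        using zero_le_power2[of "x + y"] by (simp add: power2_sum power2_diff)
      ultimately have b: "(b s)\<^sup>2 \<le> 2 * (q s)\<^sup>2 + 2 * (\<eta>\<^sup>2 * (p s)\<^sup>2)"
        by (metis power_mult_distrib)
      have "\<rho> / k\<^sup>2 \<le> \<rho> / pi\<^sup>2" using k2 pos k0 by (intro divide_left_mono) auto
      then have "\<rho> / k\<^sup>2 * (p s)\<^sup>2 \<le> \<rho> / pi\<^sup>2 * (p s)\<^sup>2" by (intro mult_right_mono) auto
      moreover have "(b s)\<^sup>2 / g \<le> (2 * (q s)\<^sup>2 + 2 * (\<eta>\<^sup>2 * (p s)\<^sup>2)) / g"
        using b g by (intro divide_right_mono) auto
      ultimately have "V s \<le> A * (\<rho> / pi\<^sup>2 * (p s)\<^sup>2 + (2 * (q s)\<^sup>2 + 2 * (\<eta>\<^sup>2 * (p s)\<^sup>2)) / g) + (q s)\<^sup>2"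
        unfolding V_def using A by (intro add_mono mult_left_mono) auto
      also have "\<dots> = (A * \<rho> / pi\<^sup>2 + 2 * A * \<eta>\<^sup>2 / g) * (p s)\<^sup>2 + (2 * A / g + 1) * (q s)\<^sup>2"
        by (simp add: algebra_simps add_divide_distrib)
      also have "\<dots> \<le> C1 * (p s)\<^sup>2 + C1 * (q s)\<^sup>2"
      proof -
        have "0 \<le> A * \<rho> / pi\<^sup>2 + 2 * A * \<eta>\<^sup>2 / g" "0 \<le> 2 * A / g + 1"
          using A g pos by (auto intro!: add_nonneg_nonneg)
        then have "A * \<rho> / pi\<^sup>2 + 2 * A * \<eta>\<^sup>2 / g \<le> C1" "2 * A / g + 1 \<le> C1"
          unfolding C1_def by linarith+
        then show ?thesis by (intro add_mono[OF mult_right_mono mult_right_mono]) auto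
      qed
      finally show ?thesis by (simp add: distrib_left)
    qed
    have dissip: "V' s \<le> - (2 * C) * V s" for s
    proof -
      \<comment> \<open>The mixed term is absorbed by completing the square.\<close>
      have "0 \<le> (\<kappa> * q s - g * p s)\<^sup>2 / \<kappa>" using \<kappa> by simp
      also have "\<dots> = \<kappa> * (q s)\<^sup>2 - 2 * (g * p s * q s) + g\<^sup>2 / \<kappa> * (p s)\<^sup>2"
        using \<kappa> by (simp add: power2_diff field_simps power2_eq_square)
      finally have 1: "2 * (g * p s * q s) \<le> \<kappa> * (q s)\<^sup>2 + g\<^sup>2 / \<kappa> * (p s)\<^sup>2" by simp
      have "\<kappa> \<le> \<eta> * k\<^sup>2 / \<rho>"
        unfolding \<kappa>_def using k2 pos by (intro divide_right_mono mult_left_mono) auto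
      then have 2: "\<kappa> * (q s)\<^sup>2 \<le> \<eta> * k\<^sup>2 / \<rho> * (q s)\<^sup>2" by (intro mult_right_mono) auto
      have 3: "2 * A * \<eta> * (p s)\<^sup>2 = 2 * (\<eta> * (p s)\<^sup>2) + g\<^sup>2 / \<kappa> * (p s)\<^sup>2"
        using \<kappa> pos by (simp add: A_def field_simps)
      have 4: "V' s \<le> - 2 * (\<eta> * (p s)\<^sup>2 + \<kappa> / 2 * (q s)\<^sup>2)"
        using 1 2 3 by (simp add: V'_def)
      have "C * V s \<le> C * (C1 * ((p s)\<^sup>2 + (q s)\<^sup>2))" using V_le C by (intro mult_left_mono) auto
      also have "\<dots> = min \<eta> (\<kappa> / 2) * (p s)\<^sup>2 + min \<eta> (\<kappa> / 2) * (q s)\<^sup>2"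
        using C1 by (simp add: C_def distrib_left)
      also have "\<dots> \<le> \<eta> * (p s)\<^sup>2 + \<kappa> / 2 * (q s)\<^sup>2"
        by (intro add_mono mult_right_mono) auto
      finally have "- 2 * (\<eta> * (p s)\<^sup>2 + \<kappa> / 2 * (q s)\<^sup>2) \<le> - 2 * (C * V s)"
        by (rule mult_left_mono_neg) simp
      with 4 show ?thesis by simp
    qed
    have Vc: "continuous_on {0..T} V" for T
      unfolding V_def using g by (intro continuous_intros pc bc qc) auto
    have decay: "V t \<le> exp (- (2 * C) * t) * V 0"
      using exponential_decay_of_dissipation[OF Vc Vd, of "2 * C" t] dissip t by simp
    have lower: "(p t)\<^sup>2 + (b t)\<^sup>2 \<le> (2 / \<eta>\<^sup>2 + 1) * (1 + g / A) * V t"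
    proof -
      have b: "A / g * (b t)\<^sup>2 + (q t)\<^sup>2 \<le> V t"
        unfolding V_def using A pos by (simp add: distrib_left)
      then have "A / g * (b t)\<^sup>2 \<le> V t" using zero_le_power2[of "q t"] by linarith
      then have b1: "(b t)\<^sup>2 \<le> g / A * V t" using A g by (simp add: field_simps)
      have "0 \<le> A / g * (b t)\<^sup>2" using A g by simp
      then have q1: "(q t)\<^sup>2 \<le> V t" using b by linarith
      have bq: "(q t)\<^sup>2 + (b t)\<^sup>2 \<le> (1 + g / A) * V t" using b1 q1 by (simp add: distrib_right)
      have "\<eta>\<^sup>2 * (p t)\<^sup>2 = (q t - b t)\<^sup>2" by (simp add: q_def power_mult_distrib)
      also have "\<dots> \<le> 2 * ((q t)\<^sup>2 + (b t)\<^sup>2)"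
        using zero_le_power2[of "q t + b t"] by (simp add: power2_sum power2_diff)
      finally have "(p t)\<^sup>2 \<le> 2 / \<eta>\<^sup>2 * ((q t)\<^sup>2 + (b t)\<^sup>2)" using pos by (simp add: field_simps)
      then have "(p t)\<^sup>2 + (b t)\<^sup>2 \<le> (2 / \<eta>\<^sup>2 + 1) * ((q t)\<^sup>2 + (b t)\<^sup>2)"
        unfolding distrib_right[of _ 1] mult_1 by (rule add_mono) simp
      also have "\<dots> \<le> (2 / \<eta>\<^sup>2 + 1) * ((1 + g / A) * V t)" using bq by (intro mult_left_mono) auto
      finally show ?thesis by (simp add: mult.assoc)
    qed
    have upper: "V 0 \<le> C1 * (3 + 2 * \<eta>\<^sup>2) * ((p 0)\<^sup>2 + (b 0)\<^sup>2)"
    proof -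
      have "(q 0)\<^sup>2 \<le> 2 * (\<eta>\<^sup>2 * (p 0)\<^sup>2) + 2 * (b 0)\<^sup>2"
        using zero_le_power2[of "\<eta> * p 0 - b 0"] by (simp add: q_def power2_sum power2_diff power_mult_distrib)
      then have "(p 0)\<^sup>2 + (q 0)\<^sup>2 \<le> (3 + 2 * \<eta>\<^sup>2) * ((p 0)\<^sup>2 + (b 0)\<^sup>2)"
        by (simp add: algebra_simps) (smt (verit) zero_le_power2 mult_nonneg_nonneg)
      then have "C1 * ((p 0)\<^sup>2 + (q 0)\<^sup>2) \<le> C1 * ((3 + 2 * \<eta>\<^sup>2) * ((p 0)\<^sup>2 + (b 0)\<^sup>2))"
        using C1 by (intro mult_left_mono) auto
      then show ?thesis using V_le[of 0] by (simp add: mult.assoc)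
    qed
    have "(2 / \<eta>\<^sup>2 + 1) * (1 + g / A) * V t
        \<le> (2 / \<eta>\<^sup>2 + 1) * (1 + g / A) * (exp (- (2 * C) * t) * (C1 * (3 + 2 * \<eta>\<^sup>2) * ((p 0)\<^sup>2 + (b 0)\<^sup>2)))"
      using A g by (intro mult_left_mono order_trans[OF decay] upper) auto
    with lower show "(p t)\<^sup>2 + (b t)\<^sup>2 \<le> M * exp (- (2 * C) * t) * ((p 0)\<^sup>2 + (b 0)\<^sup>2)"
      by (simp add: M_def mult_ac)
  qed
qed

section \<open>Exponential convergence to the steady state\<close>

lemma inner_const_cosn: "L2_inner (\<lambda>_. c) (cosn n) = (if n = 0 then c else 0)"
  using integral_cosn[of n] by (simp add: L2_inner_def)

lemma mean_eq_inner: "mean f = L2_inner f (cosn 0)"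
  by (simp add: mean_def L2_inner_def cosn_def)

context viscoelastic_solution
begin

lemma modes_solve_system: "mode_system \<rho> \<eta> lam G (real n * pi) (strain_mode n) (stress_mode n)"
  unfolding mode_system_def
  using continuous_strain_mode continuous_stress_mode strain_mode_evolution stress_mode_evolution by blast

text \<open>
The strain has no mode \<open>0\<close>, so the mean of the stress is conserved.
\<close>

lemma stress_deviation_coeff:
  assumes lam: "lam \<noteq> 0" and t: "t \<ge> 0"
  shows "L2_inner (\<lambda>y. \<tau> t y - mean (\<tau> 0)) (cosn n) = (if n = 0 then 0 else stress_mode n t)"
proof -
  have "integral {0..t} (strain_mode 0) = integral {0..t} (\<lambda>_. 0)"
    by (intro Henstock_Kurzweil_Integration.integral_cong) (simp add: strain_mode_eq)
  then have "stress_mode 0 t = stress_mode 0 0"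
    using stress_mode_evolution[OF t, of 0] lam by simp
  moreover have "L2_inner (\<lambda>y. \<tau> t y - mean (\<tau> 0)) (cosn n)
      = stress_mode n t - (if n = 0 then mean (\<tau> 0) else 0)"
    unfolding stress_mode_def
    by (subst L2_inner_diff_left)
       (auto simp: inner_const_cosn cosn_L2 H1_L2 C_time_H1[OF \<tau> t] L2_const)
  ultimately show ?thesis by (simp add: mean_eq_inner stress_mode_def)
qed

text \<open>
Summation over the modes: Parseval at time \<open>t\<close> and Bessel at time \<open>0\<close>.
\<close>

lemma norm_decay_of_mode_decay:
  assumes lam: "lam \<noteq> 0" and t: "t \<ge> 0" and K: "K \<ge> 0"
    and modes: "\<And>n. n > 0 \<Longrightarrow> (strain_mode n t)\<^sup>2 + (stress_mode n t)\<^sup>2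
        \<le> K * ((strain_mode n 0)\<^sup>2 + (stress_mode n 0)\<^sup>2)"
  defines "E \<equiv> (L2_norm (Dy (u 0)))\<^sup>2 + (L2_norm (\<tau> 0))\<^sup>2"
  shows "(L2_norm (Dy (u t)))\<^sup>2 \<le> K * E"
    and "(L2_norm (\<lambda>y. \<tau> t y - mean (\<tau> 0)))\<^sup>2 \<le> K * E"
proof -
  let ?\<sigma> = "\<lambda>y. \<tau> t y - mean (\<tau> 0)"
  have L: "Dy (u t) \<in> L2" "?\<sigma> \<in> L2" "Dy (u 0) \<in> L2" "\<tau> 0 \<in> L2"
    using t by (auto intro: Dy_L2 H1_L2 C_time_H1[OF u] C_time_H1[OF \<tau>] L2_diff[OF _ L2_const])
  have sum_le: "(\<Sum>n\<le>N. wt n * (L2_inner f (cosn n))\<^sup>2) \<le> K * E"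
    if f: "\<And>n. (L2_inner f (cosn n))\<^sup>2 \<le> K * ((strain_mode n 0)\<^sup>2 + (stress_mode n 0)\<^sup>2)" for f N
  proof -
    have "(\<Sum>n\<le>N. wt n * (L2_inner f (cosn n))\<^sup>2)
        \<le> (\<Sum>n\<le>N. wt n * (K * ((strain_mode n 0)\<^sup>2 + (stress_mode n 0)\<^sup>2)))"
      using f wt_pos by (intro sum_mono mult_left_mono) (auto intro: less_imp_le)
    also have "\<dots> = K * ((\<Sum>n\<le>N. wt n * (strain_mode n 0)\<^sup>2) + (\<Sum>n\<le>N. wt n * (stress_mode n 0)\<^sup>2))"
      by (simp add: sum_distrib_left sum.distrib[symmetric] algebra_simps)
    also have "\<dots> \<le> K * E"
      unfolding E_def strain_mode_def stress_mode_def
      using K by (intro mult_left_mono add_mono Bessel_cosn L) auto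
    finally show ?thesis .
  qed
  have le: "(strain_mode n t)\<^sup>2 \<le> K * ((strain_mode n 0)\<^sup>2 + (stress_mode n 0)\<^sup>2)"
    "(stress_mode n t)\<^sup>2 \<le> K * ((strain_mode n 0)\<^sup>2 + (stress_mode n 0)\<^sup>2)" if "n > 0" for n
    using modes[OF that] zero_le_power2[of "strain_mode n t"] zero_le_power2[of "stress_mode n t"] by linarith+
  have nonneg: "0 \<le> K * ((strain_mode n 0)\<^sup>2 + (stress_mode n 0)\<^sup>2)" for n using K by simp
  show "(L2_norm (Dy (u t)))\<^sup>2 \<le> K * E"
  proof (intro Parseval_cosn L sum_le)
    show "(L2_inner (Dy (u t)) (cosn n))\<^sup>2 \<le> K * ((strain_mode n 0)\<^sup>2 + (stress_mode n 0)\<^sup>2)" for n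
      using le(1)[of n] nonneg[of n] strain_mode_eq[OF t, of n]
      by (cases "n = 0") (simp_all add: strain_mode_def)
  qed
  show "(L2_norm ?\<sigma>)\<^sup>2 \<le> K * E"
  proof (intro Parseval_cosn L sum_le)
    show "(L2_inner ?\<sigma> (cosn n))\<^sup>2 \<le> K * ((strain_mode n 0)\<^sup>2 + (stress_mode n 0)\<^sup>2)" for n
      using le(2)[of n] nonneg[of n]
      by (cases "n = 0") (simp_all add: stress_deviation_coeff[OF lam t])
  qed
qed

end

theorem theorem3p3:
  fixes \<rho> \<eta> lam G :: real
  assumes "\<rho> > 0" and "\<eta> > 0" and "lam > 0" and "G > 0"
  shows "\<exists>C>0. \<forall>u \<tau> :: real \<Rightarrow> real \<Rightarrow> real.
    u \<in> C_time H1 H1_norm \<inter> L2loc_time H2 H2_norm \<and> \<tau> \<in> C_time H1 H1_norm \<and>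
    solves_system \<rho> \<eta> lam G u \<tau> \<and> (\<forall>t\<ge>0. zero_boundary (u t)) \<longrightarrow>
    (\<exists>C0. \<forall>\<^sub>F t in at_top.
       L2_norm (Dy (u t)) + L2_norm (\<lambda>y. \<tau> t y - mean (\<tau> 0)) \<le> C0 * exp (- C * t))"
proof -
  obtain C M where C: "C > 0" and M: "M \<ge> 0" and decay:
    "\<And>k p b t. k \<ge> pi \<Longrightarrow> mode_system \<rho> \<eta> lam G k p b \<Longrightarrow> t \<ge> 0 \<Longrightarrow>
       (p t)\<^sup>2 + (b t)\<^sup>2 \<le> M * exp (- (2 * C) * t) * ((p 0)\<^sup>2 + (b 0)\<^sup>2)"
    using mode_decay[OF assms] by blast
  show ?thesis
  proof (rule exI[of _ C], intro conjI allI impI C)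
    fix u \<tau> :: "real \<Rightarrow> real \<Rightarrow> real"
    assume H: "u \<in> C_time H1 H1_norm \<inter> L2loc_time H2 H2_norm \<and> \<tau> \<in> C_time H1 H1_norm \<and>
      solves_system \<rho> \<eta> lam G u \<tau> \<and> (\<forall>t\<ge>0. zero_boundary (u t))"
    interpret viscoelastic_solution \<rho> \<eta> lam G u \<tau>
      using H by unfold_locales auto
    define E where "E = (L2_norm (Dy (u 0)))\<^sup>2 + (L2_norm (\<tau> 0))\<^sup>2"
    have E: "E \<ge> 0" by (simp add: E_def)
    have bound: "L2_norm (Dy (u t)) + L2_norm (\<lambda>y. \<tau> t y - mean (\<tau> 0)) \<le> 2 * sqrt (M * E) * exp (- C * t)"
      if t: "t \<ge> 0" for t
    proof -
      let ?K = "M * exp (- (2 * C) * t)"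
      have modes: "(strain_mode n t)\<^sup>2 + (stress_mode n t)\<^sup>2
          \<le> ?K * ((strain_mode n 0)\<^sup>2 + (stress_mode n 0)\<^sup>2)" if n: "n > 0" for n
        by (rule decay[OF _ modes_solve_system t]) (use n in simp)
      have K: "?K * E = (sqrt (M * E) * exp (- C * t))\<^sup>2"
        using M E by (simp add: power_mult_distrib exp_double[symmetric])
      have "?K \<ge> 0" using M by simp
      note sq = norm_decay_of_mode_decay[OF _ t this modes, folded E_def, unfolded K]
      have nonneg: "0 \<le> sqrt (M * E) * exp (- C * t)" using M E by simp
      have "L2_norm (Dy (u t)) \<le> sqrt (M * E) * exp (- C * t)"
        using assms(3) by (intro power2_le_imp_le[OF sq(1) nonneg]) auto
      moreover have "L2_norm (\<lambda>y. \<tau> t y - mean (\<tau> 0)) \<le> sqrt (M * E) * exp (- C * t)"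
        using assms(3) by (intro power2_le_imp_le[OF sq(2) nonneg]) auto
      ultimately show ?thesis by simp
    qed
    show "\<exists>C0. \<forall>\<^sub>F t in at_top.
       L2_norm (Dy (u t)) + L2_norm (\<lambda>y. \<tau> t y - mean (\<tau> 0)) \<le> C0 * exp (- C * t)"
      by (intro exI[of _ "2 * sqrt (M * E)"] eventually_mono[OF eventually_ge_at_top[of 0]] bound)
  qed
qed

end
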